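(* Let $\xi$ be a positive random variable such that $\mathbb{P}(\xi>t)=t^{-\alpha}\ell(t)$ for some $\alpha\in[0,1)$ and some function $\ell$ slowly varying at $\infty$. Let $\xi_1,\xi_2,\ldots$ be independent copies of $\xi$, let $S_0=0$, $S_k=\xi_1+\ldots+\xi_k$ for $k\in\mathbb{N}$, and let $N(t)=\inf\{k\in\mathbb{N}:S_k>t\}$ for $t\ge0$. Let $W$ have the Mittag-Leffler distribution with parameter $\alpha$ (exponential with mean $1$ if $\alpha=0$). Then $$\lim_{t\to\infty}\mathbb{E}\big[e^{\theta\,\mathbb{P}(\xi>t)N(t)}\big]=\mathbb{E}\big[e^{\theta W}\big]=E_\alpha\Big(\frac{\theta}{\Gamma(1-\alpha)}\Big)<\infty\quad\text{for every }\theta\in\mathbb{R}.$$ In particular, $$\lim_{t\to\infty}\mathbb{E}\big[(\mathbb{P}(\xi>t)N(t))^p\big]=\mathbb{E}\big[W^p\big]=\frac{\Gamma(p+1)}{\Gamma(1-\alpha)^p\,\Gamma(p\alpha+1)}<\infty\quad\text{for every }p\ge0.$$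
   Context: $E_\alpha(z)=\sum_{k\ge0}\frac{z^k}{\Gamma(k\alpha+1)}$, $z\in\mathbb{R}$, is the Mittag-Leffler function with parameter $\alpha$, and $\Gamma$ is Euler's gamma function. The Mittag-Leffler distribution with parameter $\alpha$ (exponential with mean $1$ if $\alpha=0$) is, in the normalization used here, the law with moment generating function $\theta\mapsto E_\alpha\big(\frac{\theta}{\Gamma(1-\alpha)}\big)$, $\theta\in\mathbb{R}$. A function $\ell$ that is positive for all large arguments is slowly varying at $\infty$ if $\ell(xt)/\ell(t)\to1$ as $t\to\infty$ for every $x>0$.
   Formalization: For α=0 the first display fails if θ≥1 (W exponential, E[e^{θW}]=∞) and the series E_0 diverges if |θ|≥1; proved there: the limit in [0,∞] for every θ, equality with E_0(θ) for |θ|<1, and the value 1/(1-θ)<∞ for θ<1. *)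

theory Defs
  imports "HOL-Probability.Probability"
begin

(* For alpha > 0 the series converges for every real z; for alpha = 0 it is the geometric series,
   so the value is only meaningful for |z| < 1. *)
definition mittag_leffler :: "real \<Rightarrow> real \<Rightarrow> real" where
  "mittag_leffler \<alpha> z = (\<Sum>k. z ^ k / Gamma (real k * \<alpha> + 1))"

definition slowly_varying_at_top :: "(real \<Rightarrow> real) \<Rightarrow> bool" where
  "slowly_varying_at_top L \<longleftrightarrow>
     (\<forall>\<^sub>F t in at_top. L t > 0) \<and>
     (\<forall>x>0. ((\<lambda>t. L (x * t) / L t) \<longlongrightarrow> 1) at_top)"

definition mittag_leffler_distributed :: "'a measure \<Rightarrow> ('a \<Rightarrow> real) \<Rightarrow> real \<Rightarrow> bool" where
  "mittag_leffler_distributed M W \<alpha> \<longleftrightarrow>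
     (if \<alpha> = 0 then distributed M lborel W (exponential_density 1)
      else W \<in> borel_measurable M \<and>
        (\<forall>\<theta>. integrable M (\<lambda>\<omega>. exp (\<theta> * W \<omega>)) \<and>
             (\<integral>\<omega>. exp (\<theta> * W \<omega>) \<partial>M) = mittag_leffler \<alpha> (\<theta> / Gamma (1 - \<alpha>))))"

definition random_walk :: "(nat \<Rightarrow> 'a \<Rightarrow> real) \<Rightarrow> nat \<Rightarrow> 'a \<Rightarrow> real" where
  "random_walk X k \<omega> = (\<Sum>i=1..k. X i \<omega>)"

(* The infimum of the empty set is 0 in type nat rather than infinity. For i.i.d. positive steps
   the walk almost surely exceeds every level, so this only concerns a null set. *)
definition first_passage :: "(nat \<Rightarrow> 'a \<Rightarrow> real) \<Rightarrow> real \<Rightarrow> 'a \<Rightarrow> nat" where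
  "first_passage X t \<omega> = Inf {k. k \<ge> 1 \<and> random_walk X k \<omega> > t}"

end

theory Submission
  imports Defs
begin

text \<open>
  Write \<open>F(t) = P(\<xi> > t)\<close>, \<open>\<phi>(s) = E exp(-s \<xi>)\<close> and \<open>G = \<Gamma>(1 - \<alpha>)\<close>. For fixed \<open>t\<close> the function
  \<open>u \<mapsto> E exp(\<theta> F(t) N(t u))\<close> is monotone, and its Laplace transform is explicit:
  \<open>\<integral> s exp(-s u) E z^N(t u) du = z (1 - \<phi>(s/t)) / (1 - z \<phi>(s/t))\<close>. Since
  \<open>(1 - \<phi>(s/t)) / F(t) \<rightarrow> G s^\<alpha>\<close>, for \<open>z = exp(\<theta> F(t))\<close> it tends to \<open>G s^\<alpha> / (G s^\<alpha> - \<theta>)\<close> whenever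
  \<open>G s^\<alpha> > \<theta>\<close>, which for large \<open>s\<close> is the transform of \<open>E\<^sub>\<alpha>(\<theta> u^\<alpha> / G)\<close>. Karamata's polynomial
  approximation argument, applied to powers of \<open>exp(-s u)\<close>, turns this into pointwise convergence,
  and \<open>u = 1\<close> gives the exponential moments.

  For the power moments of \<open>Y = F(t) N(t)\<close> the same approximation is applied with \<open>x = exp(-Y/2)\<close> and weight \<open>exp(Y/2)\<close>, because
  \<open>Y^p\<close> is the weight times a continuous function of \<open>x \<in> [0,1]\<close>. To evaluate \<open>E W^p\<close>, let
  \<open>\<tau>\<close> be an independent standard exponential variable: \<open>\<tau>^\<alpha> G W\<close> has the moment generating function
  \<open>1/(1 - \<theta>)\<close>, hence the moments \<open>\<Gamma>(p + 1)\<close> of \<open>\<tau>\<close> itself, whereas \<open>E \<tau>^(\<alpha> p) = \<Gamma>(\<alpha> p + 1)\<close>. For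
  \<open>\<theta> \<le> -1\<close> the series of \<open>E\<^sub>\<alpha>\<close> cannot be integrated term by term; that case is read off from the limit theorem.
\<close>

section \<open>Polynomial approximation and a Tauberian theorem\<close>

text \<open>By Stone-Weierstrass \<open>g\<close> is uniformly close to a polynomial
  \<open>q\<close> on [0,1], and for \<open>q\<close> the claim is a finite linear combination of
  the limits \<open>lim\<close>. Replacing \<open>g\<close> by \<open>q\<close> costs at most the
  uniform distance times the total weight, and the total weights stay bounded because
  \<open>lim\<close> with k = 0 makes them converge. The Tauberian theorem below varies only the
  weight; the power moments vary both the weight and the variable.\<close>

lemma weighted_moments_tendsto:
  fixes M :: "'i \<Rightarrow> 'a measure" and N :: "'b measure" and g :: "real \<Rightarrow> real"
  assumes M: "\<forall>\<^sub>F i in F. integrable (M i) (w i) \<and> x i \<in> borel_measurable (M i) \<and>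
      (AE a in M i. 0 \<le> w i a \<and> 0 \<le> x i a \<and> x i a \<le> 1)"
    and N: "integrable N v" "y \<in> borel_measurable N" "AE b in N. 0 \<le> y b \<and> y b \<le> 1"
    and lim: "\<And>k. ((\<lambda>i. \<integral>a. w i a * x i a ^ k \<partial>M i) \<longlongrightarrow> (\<integral>b. v b * y b ^ k \<partial>N)) F"
    and g: "continuous_on {0..1} g" "g \<in> borel_measurable borel"
  shows "((\<lambda>i. \<integral>a. w i a * g (x i a) \<partial>M i) \<longlongrightarrow> (\<integral>b. v b * g (y b) \<partial>N)) F"
proof -
  have "bounded (g ` {0..1})"
    by (intro compact_imp_bounded compact_continuous_image g compact_Icc)
  then obtain B where B: "\<And>z. 0 \<le> z \<Longrightarrow> z \<le> 1 \<Longrightarrow> \<bar>g z\<bar> \<le> B"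
    unfolding bounded_iff by fastforce
  \<comment> \<open>This and the auxiliary facts below are stated for measures on an arbitrary type,
    because they serve both for \<open>M i\<close> and for \<open>N\<close>.\<close>
  have int: "integrable K (\<lambda>a. u a * h (z a))"
    if "integrable K u" "z \<in> borel_measurable K" "AE a in K. 0 \<le> z a \<and> z a \<le> 1"
      "h \<in> borel_measurable borel" "\<And>z. 0 \<le> z \<Longrightarrow> z \<le> 1 \<Longrightarrow> \<bar>h z\<bar> \<le> (C::real)"
    for K :: "'c measure" and u z and h :: "real \<Rightarrow> real" and C
  proof (rule Bochner_Integration.integrable_bound)
    note [measurable] = that(2,4) borel_measurable_integrable[OF that(1)]
    show "integrable K (\<lambda>a. C * u a)" using that(1) by simp
    show "(\<lambda>a. u a * h (z a)) \<in> borel_measurable K" by measurable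
    have "0 \<le> C" using order_trans[OF abs_ge_zero that(5)[of 0]] by simp
    show "AE a in K. norm (u a * h (z a)) \<le> norm (C * u a)"
      using that(3)
    proof eventually_elim
      case (elim a)
      have "\<bar>h (z a)\<bar> * \<bar>u a\<bar> \<le> C * \<bar>u a\<bar>"
        using that(5)[of "z a"] elim by (intro mult_right_mono) auto
      then show ?case using \<open>0 \<le> C\<close> by (simp add: abs_mult mult.commute)
    qed
  qed
  note [measurable] = N(2)
  show ?thesis
  proof (rule tendstoI)
    fix e :: real assume e: "e > 0"
    define A where "A = (\<integral>b. \<bar>v b\<bar> \<partial>N)"
    define B0 where "B0 = (\<integral>b. v b \<partial>N)"
    have A: "A \<ge> 0" unfolding A_def by simp
    have B0A: "B0 \<le> A" unfolding A_def B0_def using N(1) by (intro integral_mono) auto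
    \<comment> \<open>The total weight is eventually below B0 + 1 \<le> A + 1, so each replacement
      of \<open>g\<close> by \<open>q\<close> costs at most e / 4. With e / 4 for the polynomial
      itself the sum stays below e.\<close>
    define d where "d = e / (4 * (A + 1))"
    have d: "d > 0" "d * (A + 1) \<le> e / 4" using e A by (auto simp: d_def field_simps)
    obtain q where q: "real_polynomial_function q" "\<And>z. z \<in> {0..1} \<Longrightarrow> \<bar>g z - q z\<bar> < d"
      using Stone_Weierstrass_real_polynomial_function[OF compact_Icc g(1) d(1)] by blast
    obtain c n where qs: "q = (\<lambda>z. \<Sum>k\<le>n. c k * z ^ k)"
      using q(1) unfolding real_polynomial_function_iff_sum by blast
    have qm[measurable]: "q \<in> borel_measurable borel" unfolding qs by measurable
    have qb: "\<bar>q z\<bar> \<le> B + d" if "0 \<le> z" "z \<le> 1" for z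
      using q(2)[of z] B[of z] that by auto
    have qint: "(\<integral>a. u a * q (z a) \<partial>K) = (\<Sum>k\<le>n. c k * (\<integral>a. u a * z a ^ k \<partial>K))"
      if "integrable K u" "z \<in> borel_measurable K" "AE a in K. 0 \<le> z a \<and> z a \<le> 1"
      for K :: "'c measure" and u z
    proof -
      have "integrable K (\<lambda>a. u a * (\<lambda>z. z ^ k) (z a))" for k
        using that by (intro int[of K u z "\<lambda>z. z ^ k" 1]) (auto simp: power_abs intro!: power_le_one)
      then show ?thesis unfolding qs
        by (simp add: sum_distrib_left mult.left_commute Bochner_Integration.integral_sum)
    qed
    have diff: "\<bar>(\<integral>a. u a * g (z a) \<partial>K) - (\<integral>a. u a * q (z a) \<partial>K)\<bar> \<le> d * (\<integral>a. \<bar>u a\<bar> \<partial>K)"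
      if "integrable K u" "z \<in> borel_measurable K" "AE a in K. 0 \<le> z a \<and> z a \<le> 1"
      for K :: "'c measure" and u z
    proof -
      note i1 = int[OF that g(2) B] and i2 = int[OF that qm qb]
      have "(\<integral>a. u a * g (z a) \<partial>K) - (\<integral>a. u a * q (z a) \<partial>K) = (\<integral>a. u a * (g (z a) - q (z a)) \<partial>K)"
        using i1 i2 by (simp add: right_diff_distrib)
      also have "\<bar>\<dots>\<bar> \<le> (\<integral>a. \<bar>u a * (g (z a) - q (z a))\<bar> \<partial>K)" by simp
      also have "\<dots> \<le> (\<integral>a. d * \<bar>u a\<bar> \<partial>K)"
      proof (rule integral_mono_AE)
        show "integrable K (\<lambda>a. \<bar>u a * (g (z a) - q (z a))\<bar>)"
          using i1 i2 by (simp add: right_diff_distrib)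
        show "AE a in K. \<bar>u a * (g (z a) - q (z a))\<bar> \<le> d * \<bar>u a\<bar>"
          using that(3)
        proof eventually_elim
          case (elim a)
          then show ?case using q(2)[of "z a"]
            by (auto simp: abs_mult mult.commute[of d] intro!: mult_left_mono)
        qed
      qed (use that in auto)
      finally show ?thesis by simp
    qed
    have "((\<lambda>i. \<Sum>k\<le>n. c k * (\<integral>a. w i a * x i a ^ k \<partial>M i)) \<longlongrightarrow> (\<Sum>k\<le>n. c k * (\<integral>b. v b * y b ^ k \<partial>N))) F"
      by (intro tendsto_intros lim)
    then have ev1: "\<forall>\<^sub>F i in F. dist (\<Sum>k\<le>n. c k * (\<integral>a. w i a * x i a ^ k \<partial>M i))
        (\<Sum>k\<le>n. c k * (\<integral>b. v b * y b ^ k \<partial>N)) < e / 4"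
      using e by (intro tendstoD) auto
    have "((\<lambda>i. \<integral>a. w i a \<partial>M i) \<longlongrightarrow> B0) F"
      using lim[of 0] by (simp add: B0_def)
    then have ev2: "\<forall>\<^sub>F i in F. (\<integral>a. w i a \<partial>M i) < B0 + 1"
      by (rule order_tendstoD) auto
    show "\<forall>\<^sub>F i in F. dist (\<integral>a. w i a * g (x i a) \<partial>M i) (\<integral>b. v b * g (y b) \<partial>N) < e"
      using M ev1 ev2
    proof eventually_elim
      case (elim i)
      then have Mi: "integrable (M i) (w i)" "x i \<in> borel_measurable (M i)"
        "AE a in M i. 0 \<le> x i a \<and> x i a \<le> 1" and pos: "AE a in M i. 0 \<le> w i a" by auto
      note [measurable] = borel_measurable_integrable[OF Mi(1)]
      have "(\<integral>a. \<bar>w i a\<bar> \<partial>M i) = (\<integral>a. w i a \<partial>M i)"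
        using pos by (intro integral_cong_AE) auto
      then have "d * (\<integral>a. \<bar>w i a\<bar> \<partial>M i) \<le> d * (A + 1)"
        using elim(3) B0A d(1) by (intro mult_left_mono) auto
      with diff[OF Mi] d have 1: "\<bar>(\<integral>a. w i a * g (x i a) \<partial>M i) - (\<integral>a. w i a * q (x i a) \<partial>M i)\<bar> \<le> e / 4"
        by linarith
      have "d * A \<le> d * (A + 1)" using d(1) by (simp add: mult_left_mono)
      then have 2: "\<bar>(\<integral>b. v b * g (y b) \<partial>N) - (\<integral>b. v b * q (y b) \<partial>N)\<bar> \<le> e / 4"
        using diff[OF N] d unfolding A_def by linarith
      show ?case using 1 2 elim(2) e unfolding dist_real_def qint[OF Mi] qint[OF N] by linarith
    qed
  qed
qed

section \<open>Exponential laws as normalised Laplace kernels\<close>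

definition exp_law :: "real \<Rightarrow> real measure" where
  "exp_law s = density lborel (exponential_density s)"

lemma space_exp_law [simp]: "space (exp_law s) = UNIV"
  and sets_exp_law [simp, measurable_cong]: "sets (exp_law s) = sets borel"
  by (auto simp: exp_law_def)

lemma prob_space_exp_law: "s > 0 \<Longrightarrow> prob_space (exp_law s)"
  unfolding exp_law_def by (rule prob_space_exponential_density)

lemma AE_exp_law_pos: "AE u in exp_law s. u > 0"
proof -
  have "AE u in lborel. u \<noteq> (0::real)" by (rule AE_lborel_singleton)
  then show ?thesis unfolding exp_law_def
    by (subst AE_density) (auto elim!: eventually_mono simp: exponential_density_def)
qed

text \<open>Half-open intervals are what the walk produces: on almost every path and for v \<ge> 0,
  the first passage over v happens at step n + 1 exactly when v lies in [S n, S (n + 1)).\<close>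

lemma emeasure_exp_law_atLeastLessThan:
  assumes "s > 0" "0 \<le> a" "a \<le> b"
  shows "emeasure (exp_law s) {a..<b} = ennreal (exp (- s * a) - exp (- s * b))"
proof -
  interpret prob_space "exp_law s" by (rule prob_space_exp_law[OF assms(1)])
  have D: "distributed (exp_law s) lborel (\<lambda>u. u) (exponential_density s)"
    unfolding distributed_def exp_law_def by (auto intro!: distr_id2)
  have sing: "prob {c} = 0" for c
  proof -
    have "emeasure (exp_law s) {c} = 0" unfolding exp_law_def
      by (subst emeasure_density) (auto simp: nn_integral_cmult_indicator intro!: nn_integral_null_set simp: null_sets_def)
    then show ?thesis by (simp add: measure_def)
  qed
  have le: "prob {..c} = 1 - exp (- c * s)" if "0 \<le> c" for c
    using exponential_distributedD_le[OF D that assms(1)] by (simp add: atMost_def)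
  have "prob {..<c} = 1 - exp (- c * s)" if "0 \<le> c" for c
  proof -
    have "{..c} = {..<c} \<union> {c}" by auto
    then have "prob {..c} = prob {..<c} + prob {c}" by (simp del: Un_insert_right add: finite_measure_Union)
    then show ?thesis using sing[of c] le[OF that] by simp
  qed
  note lt = this
  have "prob {a..<b} = prob {..<b} - prob {..<a}"
    using assms by (subst finite_measure_Diff[symmetric]) (auto intro!: arg_cong[where f = prob])
  also have "\<dots> = exp (- s * a) - exp (- s * b)" using lt assms by (simp add: mult.commute)
  finally show ?thesis by (simp add: emeasure_eq_measure)
qed

text \<open>Linear substitution in the density. It turns the transform of u \<mapsto> f (t u) at a
  fixed rate s into the transform of f at the rate s / t, which tends to 0 as t grows.\<close>

lemma distr_exp_law_scale:
  assumes "s > 0" "t > 0"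
  shows "distr (exp_law s) borel (\<lambda>u. t * u) = exp_law (s / t)"
proof (rule measure_eqI)
  fix A assume "A \<in> sets (distr (exp_law s) borel (\<lambda>u. t * u))"
  then have [measurable]: "A \<in> sets borel" by simp
  have [measurable]: "(\<lambda>u. t * u) -` A \<in> sets borel"
    by (rule measurable_sets_borel[of _ borel]) measurable
  have "emeasure (distr (exp_law s) borel (\<lambda>u. t * u)) A
      = (\<integral>\<^sup>+u. ennreal (exponential_density s u) * indicator A (t * u) \<partial>lborel)"
    unfolding exp_law_def
    by (subst emeasure_distr, simp, simp, subst emeasure_density)
      (auto simp: indicator_def intro!: nn_integral_cong)
  \<comment> \<open>The summand 0 puts the integrand into the shape of the affine substitution rule
    \<open>nn_integral_real_affine\<close>.\<close>
  also have "\<dots> = (\<integral>\<^sup>+u. ennreal t * (ennreal (exponential_density (s / t) (0 + t * u)) * indicator A (0 + t * u)) \<partial>lborel)"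
    using assms
    by (intro nn_integral_cong)
      (auto simp: exponential_density_def mult_less_0_iff ennreal_mult[symmetric] indicator_def)
  also have "\<dots> = ennreal t * (\<integral>\<^sup>+u. (ennreal (exponential_density (s / t) (0 + t * u)) * indicator A (0 + t * u)) \<partial>lborel)"
    by (rule nn_integral_cmult) measurable
  also have "\<dots> = (\<integral>\<^sup>+u. (ennreal (exponential_density (s / t) u) * indicator A u) \<partial>lborel)"
    using assms by (subst nn_integral_real_affine[where c = t and t = 0]) auto
  also have "\<dots> = emeasure (exp_law (s / t)) A"
    unfolding exp_law_def by (simp add: emeasure_density)
  finally show "emeasure (distr (exp_law s) borel (\<lambda>u. t * u)) A = emeasure (exp_law (s / t)) A" .
qed simp

lemma nn_integral_exp_law_scale:
  assumes "s > 0" "t > 0" and [measurable]: "f \<in> borel_measurable borel"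
  shows "(\<integral>\<^sup>+u. f (t * u) \<partial>exp_law s) = (\<integral>\<^sup>+u. f u \<partial>exp_law (s / t))"
  unfolding distr_exp_law_scale[OF assms(1,2), symmetric] by (simp add: nn_integral_distr)

lemma integral_exp_law_scale:
  fixes f :: "real \<Rightarrow> real"
  assumes "s > 0" "t > 0" and [measurable]: "f \<in> borel_measurable borel"
  shows "(\<integral>u. f (t * u) \<partial>exp_law s) = (\<integral>u. f u \<partial>exp_law (s / t))"
  unfolding distr_exp_law_scale[OF assms(1,2), symmetric] by (simp add: integral_distr)

text \<open>Multiplying the density s exp(-s u) by the k-th power of exp(-s u) gives 1 / (k + 1)
  times the density of rate s (k + 1). Moments of the variable exp(-s u) are therefore Laplace
  transforms along the progression s, 2 s, 3 s and so on.\<close>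

lemma integral_exp_law_tilt:
  fixes f :: "real \<Rightarrow> real"
  assumes "s > 0" and [measurable]: "f \<in> borel_measurable borel"
  shows "(\<integral>u. f u * exp (- s * u) ^ k \<partial>exp_law s) = (\<integral>u. f u \<partial>exp_law (s * real (Suc k))) / real (Suc k)"
proof -
  have "(\<integral>u. f u * exp (- s * u) ^ k \<partial>exp_law s)
      = (\<integral>u. exponential_density s u * (f u * exp (- s * u) ^ k) \<partial>lborel)"
    unfolding exp_law_def using assms(1) by (subst integral_density) (auto simp: exponential_density_nonneg)
  also have "\<dots> = (\<integral>u. exponential_density (s * real (Suc k)) u * f u / real (Suc k) \<partial>lborel)"
    by (intro Bochner_Integration.integral_cong refl)
      (auto simp: exponential_density_def exp_of_nat_mult[symmetric] mult_exp_exp exp_add[symmetric] field_simps)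
  also have "\<dots> = (\<integral>u. exponential_density (s * real (Suc k)) u * f u \<partial>lborel) / real (Suc k)"
    by (rule integral_divide_zero)
  also have "(\<integral>u. exponential_density (s * real (Suc k)) u * f u \<partial>lborel) = (\<integral>u. f u \<partial>exp_law (s * real (Suc k)))"
    unfolding exp_law_def using assms(1)
    by (subst integral_density) (auto intro!: exponential_density_nonneg mult_pos_pos simp del: of_nat_Suc)
  finally show ?thesis .
qed

lemma nn_integral_exp_law_powr:
  assumes "s > 0" "p > -1"
  shows "(\<integral>\<^sup>+u. ennreal (u powr p) \<partial>exp_law s) = ennreal (Gamma (p + 1) / s powr p)"
proof -
  have 1: "(\<integral>\<^sup>+u. ennreal (u powr p) \<partial>exp_law 1) = ennreal (Gamma (p + 1))"
  proof -
    have "(\<integral>\<^sup>+u. ennreal (u powr p) \<partial>exp_law 1) = (\<integral>\<^sup>+u. ennreal (exponential_density 1 u) * ennreal (u powr p) \<partial>lborel)"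
      unfolding exp_law_def by (subst nn_integral_density) auto
    also have "\<dots> = (\<integral>\<^sup>+u. ennreal (indicator {0..} u * u powr ((p + 1) - 1) / exp u) \<partial>lborel)"
      by (intro nn_integral_cong)
        (auto simp: exponential_density_def indicator_def ennreal_mult[symmetric] exp_minus field_simps)
    also have "\<dots> = ennreal (Gamma (p + 1))"
      using assms by (intro Gamma_conv_nn_integral_real[symmetric]) auto
    finally show ?thesis .
  qed
  have "(\<integral>\<^sup>+u. ennreal (u powr p) \<partial>exp_law s) = (\<integral>\<^sup>+u. ennreal (u powr p) \<partial>exp_law (1 / (1 / s)))"
    by simp
  also have "\<dots> = (\<integral>\<^sup>+u. ennreal ((1 / s * u) powr p) \<partial>exp_law 1)"
    using assms by (intro nn_integral_exp_law_scale[symmetric]) auto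
  also have "\<dots> = (\<integral>\<^sup>+u. ennreal ((1 / s) powr p) * ennreal (u powr p) \<partial>exp_law 1)"
    using AE_exp_law_pos[of 1]
    by (intro nn_integral_cong_AE, eventually_elim)
      (use assms in \<open>simp add: powr_mult[symmetric] ennreal_mult[symmetric]\<close>)
  also have "\<dots> = ennreal ((1 / s) powr p) * ennreal (Gamma (p + 1))"
    by (subst nn_integral_cmult) (auto simp: 1)
  also have "\<dots> = ennreal (Gamma (p + 1) / s powr p)"
    using assms by (simp add: ennreal_mult[symmetric] powr_divide Gamma_real_nonneg)
  finally show ?thesis .
qed

text \<open>Karamata's argument. By \<open>weighted_moments_tendsto\<close> the integrals of
  \<open>f i\<close> against continuous functions of exp(-s u) converge. A bump supported to the
  right of u0 has, by monotonicity, an integral against \<open>f i\<close> of at least f i u0 times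
  its mass; a bump to the left gives the opposite inequality. On short intervals continuity of h
  puts the limits of these integrals close to h u0 times the mass.\<close>

lemma laplace_mono_tendsto:
  fixes f :: "'i \<Rightarrow> real \<Rightarrow> real"
  assumes s: "s > 0" and u0: "u0 > 0"
    and f: "\<forall>\<^sub>F i in F. integrable (exp_law s) (f i) \<and> (\<forall>u>0. 0 \<le> f i u) \<and>
        (\<forall>u v. 0 < u \<longrightarrow> u \<le> v \<longrightarrow> f i u \<le> f i v)"
    and h: "integrable (exp_law s) h" "isCont h u0"
    and lim: "\<And>k. ((\<lambda>i. \<integral>u. f i u \<partial>exp_law (s * real (Suc k))) \<longlongrightarrow>
        (\<integral>u. h u \<partial>exp_law (s * real (Suc k)))) F"
  shows "((\<lambda>i. f i u0) \<longlongrightarrow> h u0) F"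
proof -
  interpret E: prob_space "exp_law s" by (rule prob_space_exp_law[OF s])
  \<comment> \<open>The cut-off at 1 acts only for negative u, a null set, and keeps
    \<open>x\<close> inside [0,1] everywhere.\<close>
  define x where "x u = min 1 (exp (- s * u))" for u
  have x01: "0 \<le> x u" "x u \<le> 1" for u by (auto simp: x_def)
  have [measurable]: "x \<in> borel_measurable borel" unfolding x_def by measurable
  have xk: "(\<integral>u. p u * x u ^ k \<partial>exp_law s) = (\<integral>u. p u \<partial>exp_law (s * real (Suc k))) / real (Suc k)"
    if "integrable (exp_law s) p" for p :: "real \<Rightarrow> real" and k
  proof -
    have [measurable]: "p \<in> borel_measurable borel"
      using borel_measurable_integrable[OF that] by (simp cong: measurable_cong_sets)
    have "(\<integral>u. p u * x u ^ k \<partial>exp_law s) = (\<integral>u. p u * exp (- s * u) ^ k \<partial>exp_law s)"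
    proof (rule integral_cong_AE)
      show "AE u in exp_law s. p u * x u ^ k = p u * exp (- s * u) ^ k"
        using AE_exp_law_pos[of s] by eventually_elim (use s in \<open>simp add: x_def min_def mult_le_0_iff\<close>)
    qed measurable
    then show ?thesis using integral_exp_law_tilt[OF s, of p k] by simp
  qed
  \<comment> \<open>For a < b this is a triangular bump in z between exp(-s b) and exp(-s a). After
    z = exp(-s u) it is supported in u on [a,b], while it stays continuous in z, as the polynomial
    approximation requires.\<close>
  define \<phi> where "\<phi> a b z = max 0 (min (z - exp (- s * b)) (exp (- s * a) - z))" for a b z :: real
  have \<phi>0: "\<phi> a b z \<ge> 0" for a b z by (simp add: \<phi>_def)
  have \<phi>1: "\<phi> a b (x u) = 0" if "u > 0" "u \<notin> {a..b}" for a b u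
  proof -
    have "x u = exp (- s * u)" using that(1) s by (simp add: x_def)
    moreover have "exp (- s * u) \<le> exp (- s * b) \<or> exp (- s * a) \<le> exp (- s * u)"
      using that(2) s by auto
    moreover have "\<phi> a b z = 0" if "z \<le> exp (- s * b) \<or> exp (- s * a) \<le> z" for z
      using that by (auto simp: \<phi>_def max_def min_def)
    ultimately show ?thesis by metis
  qed
  have \<phi>c: "continuous_on S (\<phi> a b)" for S a b
    unfolding \<phi>_def by (intro continuous_intros)
  have [measurable]: "\<phi> a b \<in> borel_measurable borel" for a b
    by (rule borel_measurable_continuous_onI[OF \<phi>c])
  have \<phi>b: "\<phi> a b (x u) \<le> 1 + \<bar>exp (- s * a)\<bar>" for a b u
    using x01[of u] unfolding \<phi>_def by (auto simp: min_def max_def)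
  have int\<phi>: "integrable (exp_law s) (\<lambda>u. p u * \<phi> a b (x u))"
    if "integrable (exp_law s) p" for p :: "real \<Rightarrow> real" and a b
  proof (rule Bochner_Integration.integrable_bound)
    note [measurable] = borel_measurable_integrable[OF that]
    show "integrable (exp_law s) (\<lambda>u. (1 + \<bar>exp (- s * a)\<bar>) * p u)" using that by simp
    show "(\<lambda>u. p u * \<phi> a b (x u)) \<in> borel_measurable (exp_law s)" by measurable
    have "\<phi> a b (x u) * \<bar>p u\<bar> \<le> (1 + \<bar>exp (- s * a)\<bar>) * \<bar>p u\<bar>" for u
      by (intro mult_right_mono \<phi>b) auto
    then show "AE u in exp_law s. norm (p u * \<phi> a b (x u)) \<le> norm ((1 + \<bar>exp (- s * a)\<bar>) * p u)"
      by (auto simp: abs_mult abs_of_nonneg[OF \<phi>0] mult.commute)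
  qed
  define I where "I a b = (\<integral>u. \<phi> a b (x u) \<partial>exp_law s)" for a b
  have int1: "integrable (exp_law s) (\<lambda>u. \<phi> a b (x u))" for a b
    using int\<phi>[of "\<lambda>_. 1" a b] by simp
  have Ipos: "I a b > 0" if ab: "0 < a" "a < b" for a b
  proof -
    have "I a b \<noteq> 0"
    proof
      assume "I a b = 0"
      then have "AE u in exp_law s. \<phi> a b (x u) = 0"
        unfolding I_def using int1 \<phi>0 by (subst (asm) integral_nonneg_eq_0_iff_AE) auto
      moreover have "\<phi> a b (x u) > 0" if "u \<in> {a<..<b}" for u
      proof -
        have "x u = exp (- s * u)" using that ab s by (simp add: x_def)
        moreover have "exp (- s * b) < exp (- s * u)" "exp (- s * u) < exp (- s * a)"
          using that s by auto
        ultimately show ?thesis by (simp add: \<phi>_def)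
      qed
      ultimately have "AE u in exp_law s. u \<notin> {a<..<b}"
        by (elim eventually_mono) force
      \<comment> \<open>The right half of the interval, taken half-open, suffices for the
        contradiction and has the explicit mass of
        \<open>emeasure_exp_law_atLeastLessThan\<close>.\<close>
      then have "AE u in exp_law s. u \<notin> {(a+b)/2..<b}"
        by (rule eventually_mono) (use ab in auto)
      then have "emeasure (exp_law s) {(a+b)/2..<b} = 0"
        by (intro AE_iff_measurable[THEN iffD1, rotated 2]) auto
      then show False using ab s by (simp add: emeasure_exp_law_atLeastLessThan)
    qed
    moreover have "I a b \<ge> 0" unfolding I_def using \<phi>0 by (simp add: Bochner_Integration.integral_nonneg)
    ultimately show ?thesis by simp
  qed
  have conv: "((\<lambda>i. \<integral>u. f i u * \<phi> a b (x u) \<partial>exp_law s) \<longlongrightarrow> (\<integral>u. h u * \<phi> a b (x u) \<partial>exp_law s)) F" for a b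
  proof (rule weighted_moments_tendsto[where w = f and x = "\<lambda>_. x" and g = "\<phi> a b"])
    show "\<forall>\<^sub>F i in F. integrable (exp_law s) (f i) \<and> x \<in> borel_measurable (exp_law s) \<and>
        (AE a in exp_law s. 0 \<le> f i a \<and> 0 \<le> x a \<and> x a \<le> 1)"
      using f
    proof eventually_elim
      case (elim i)
      then show ?case using AE_exp_law_pos[of s] x01 by (auto elim!: eventually_mono)
    qed
    show "((\<lambda>i. \<integral>u. f i u * x u ^ k \<partial>exp_law s) \<longlongrightarrow> (\<integral>u. h u * x u ^ k \<partial>exp_law s)) F" for k
      unfolding xk[OF h(1)]
      by (rule Lim_transform_eventually[OF tendsto_divide[OF lim tendsto_const]])
        (use f in \<open>auto elim!: eventually_mono simp: xk\<close>)
  qed (use h(1) x01 \<phi>c in auto)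
  show ?thesis
  proof (rule order_tendstoI)
    fix c assume c: "c > h u0"
    define e where "e = (c - h u0) / 2"
    have e: "e > 0" using c by (simp add: e_def)
    from h(2)[unfolded continuous_at_eps_delta, rule_format, OF e] obtain d where d: "d > 0"
      "\<And>u. \<bar>u - u0\<bar> < d \<Longrightarrow> \<bar>h u - h u0\<bar> < e" by (auto simp: dist_real_def)
    \<comment> \<open>For the upper bound the bump sits to the right of u0, where f i u0 \<le> f i
      u. On this interval h exceeds h u0 by at most e, half of the gap to c, which leaves a strict
      inequality.\<close>
    define a b where "a = u0" and "b = u0 + d / 2"
    have ab: "0 < a" "a < b" using u0 d by (auto simp: a_def b_def)
    have "(\<integral>u. h u * \<phi> a b (x u) \<partial>exp_law s) \<le> (\<integral>u. (h u0 + e) * \<phi> a b (x u) \<partial>exp_law s)"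
    proof (rule integral_mono_AE)
      show "AE u in exp_law s. h u * \<phi> a b (x u) \<le> (h u0 + e) * \<phi> a b (x u)"
        using AE_exp_law_pos[of s]
      proof eventually_elim
        case (elim u)
        show ?case
        proof (cases "u \<in> {a..b}")
          case True
          then have "h u \<le> h u0 + e" using d(2)[of u] d(1) by (auto simp: a_def b_def)
          then show ?thesis by (intro mult_right_mono \<phi>0)
        qed (simp add: \<phi>1 elim)
      qed
    qed (use h int\<phi> int1 in auto)
    also have "\<dots> = (h u0 + e) * I a b" by (simp add: I_def)
    also have "\<dots> < c * I a b" using c by (intro mult_strict_right_mono Ipos ab) (simp add: e_def field_simps)
    finally have "\<forall>\<^sub>F i in F. (\<integral>u. f i u * \<phi> a b (x u) \<partial>exp_law s) < c * I a b"
      by (rule order_tendstoD[OF conv])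
    then show "\<forall>\<^sub>F i in F. f i u0 < c" using f
    proof eventually_elim
      case (elim i)
      note fi = elim(2)
      have "f i u0 * I a b = (\<integral>u. f i u0 * \<phi> a b (x u) \<partial>exp_law s)" by (simp add: I_def)
      also have "\<dots> \<le> (\<integral>u. f i u * \<phi> a b (x u) \<partial>exp_law s)"
      proof (rule integral_mono_AE)
        show "AE u in exp_law s. f i u0 * \<phi> a b (x u) \<le> f i u * \<phi> a b (x u)"
          using AE_exp_law_pos[of s]
        proof eventually_elim
          case (elim u)
          show ?case
          proof (cases "u \<in> {a..b}")
            case True
            then have "f i u0 \<le> f i u" using fi u0 by (auto simp: a_def)
            then show ?thesis by (intro mult_right_mono \<phi>0)
          qed (simp add: \<phi>1 elim)
        qed
      qed (use elim int\<phi> int1 in auto)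
      finally have "f i u0 * I a b < c * I a b" using elim(1) by simp
      then show ?case using Ipos[OF ab] by simp
    qed
  next
    fix c assume c: "c < h u0"
    define e where "e = (h u0 - c) / 2"
    have e: "e > 0" using c by (simp add: e_def)
    from h(2)[unfolded continuous_at_eps_delta, rule_format, OF e] obtain d where d: "d > 0"
      "\<And>u. \<bar>u - u0\<bar> < d \<Longrightarrow> \<bar>h u - h u0\<bar> < e" by (auto simp: dist_real_def)
    \<comment> \<open>For the lower bound the bump sits to the left of u0. The maximum with u0 / 2
      keeps its support among the positive reals, where monotonicity is assumed.\<close>
    define a b where "a = max (u0 / 2) (u0 - d / 2)" and "b = u0"
    have ab: "0 < a" "a < b" using u0 d by (auto simp: a_def b_def)
    have "c * I a b < (h u0 - e) * I a b"
      using c by (intro mult_strict_right_mono Ipos ab) (simp add: e_def field_simps)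
    also have "\<dots> = (\<integral>u. (h u0 - e) * \<phi> a b (x u) \<partial>exp_law s)" by (simp add: I_def)
    also have "\<dots> \<le> (\<integral>u. h u * \<phi> a b (x u) \<partial>exp_law s)"
    proof (rule integral_mono_AE)
      show "AE u in exp_law s. (h u0 - e) * \<phi> a b (x u) \<le> h u * \<phi> a b (x u)"
        using AE_exp_law_pos[of s]
      proof eventually_elim
        case (elim u)
        show ?case
        proof (cases "u \<in> {a..b}")
          case True
          then have "h u0 - e \<le> h u" using d(2)[of u] d(1) by (auto simp: a_def b_def abs_less_iff)
          then show ?thesis by (intro mult_right_mono \<phi>0)
        qed (simp add: \<phi>1 elim)
      qed
    qed (use h int\<phi> int1 in auto)
    finally have "\<forall>\<^sub>F i in F. c * I a b < (\<integral>u. f i u * \<phi> a b (x u) \<partial>exp_law s)"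
      by (rule order_tendstoD[OF conv])
    then show "\<forall>\<^sub>F i in F. c < f i u0" using f
    proof eventually_elim
      case (elim i)
      note fi = elim(2)
      have "(\<integral>u. f i u * \<phi> a b (x u) \<partial>exp_law s) \<le> (\<integral>u. f i u0 * \<phi> a b (x u) \<partial>exp_law s)"
      proof (rule integral_mono_AE)
        show "AE u in exp_law s. f i u * \<phi> a b (x u) \<le> f i u0 * \<phi> a b (x u)"
          using AE_exp_law_pos[of s]
        proof eventually_elim
          case (elim u)
          show ?case
          proof (cases "u \<in> {a..b}")
            case True
            then have "f i u \<le> f i u0" using fi elim by (auto simp: b_def)
            then show ?thesis by (intro mult_right_mono \<phi>0)
          qed (simp add: \<phi>1 elim)
        qed
      qed (use elim int\<phi> int1 in auto)
      also have "\<dots> = f i u0 * I a b" by (simp add: I_def)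
      finally have "c * I a b < f i u0 * I a b" using elim(1) by simp
      then show ?case using Ipos[OF ab] by simp
    qed
  qed
qed

section \<open>Random walks with positive steps\<close>

locale positive_iid_walk = prob_space +
  fixes X :: "nat \<Rightarrow> 'a \<Rightarrow> real"
  assumes indep: "indep_vars (\<lambda>_. borel) X {1..}"
    and ident: "\<And>i. i \<ge> 1 \<Longrightarrow> distr M borel (X i) = distr M borel (X 1)"
    and pos: "AE \<omega> in M. X 1 \<omega> > 0"
begin

definition lap :: "real \<Rightarrow> real" where "lap s = expectation (\<lambda>\<omega>. exp (- s * X 1 \<omega>))"

definition tail :: "real \<Rightarrow> real" where "tail t = \<P>(\<omega> in M. X 1 \<omega> > t)"

abbreviation S :: "nat \<Rightarrow> 'a \<Rightarrow> real" where "S \<equiv> random_walk X"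

abbreviation N :: "real \<Rightarrow> 'a \<Rightarrow> nat" where "N \<equiv> first_passage X"

text \<open>Valued in \<open>ennreal\<close>, because for z > 1 the expectation may be infinite and
  its finiteness has to be proved.\<close>

definition pgf :: "real \<Rightarrow> real \<Rightarrow> ennreal" where
  "pgf z v = (\<integral>\<^sup>+\<omega>. ennreal (z ^ N v \<omega>) \<partial>M)"

lemma X_measurable: "i \<ge> 1 \<Longrightarrow> X i \<in> borel_measurable M"
  using indep by (auto simp: indep_vars_def)

lemma X1_measurable [measurable]: "X 1 \<in> borel_measurable M" "X (Suc 0) \<in> borel_measurable M"
  using X_measurable[of 1] by simp_all

lemma S_measurable [measurable]: "S n \<in> borel_measurable M"
  unfolding random_walk_def[abs_def] by (intro borel_measurable_sum X_measurable) auto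

lemma S_0 [simp]: "S 0 \<omega> = 0"
  and S_Suc: "S (Suc n) \<omega> = S n \<omega> + X (Suc n) \<omega>"
  by (auto simp: random_walk_def)

lemma AE_X_pos: "AE \<omega> in M. \<forall>i\<ge>1. X i \<omega> > 0"
proof -
  have "AE \<omega> in M. X i \<omega> > 0" if "i \<ge> 1" for i
  proof -
    have "AE x in distr M borel (X i). x > 0"
      unfolding ident[OF that] using pos by (subst AE_distr_iff) auto
    then show ?thesis using X_measurable[OF that] by (subst (asm) AE_distr_iff) auto
  qed
  then show ?thesis by (simp add: AE_all_countable)
qed

lemma lap_bounds:
  assumes "s > 0"
  shows "0 < lap s" "lap s < 1"
proof -
  have int: "integrable M (\<lambda>\<omega>. exp (- s * X 1 \<omega>))"
    using pos assms by (intro integrable_const_bound[where B = 1]) (auto elim!: eventually_mono)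
  have "(\<integral>\<omega>. 0 \<partial>M) < (\<integral>\<omega>. exp (- s * X 1 \<omega>) \<partial>M)"
    using int by (intro integral_less_AE_space) (auto simp: emeasure_space_1)
  then show "0 < lap s" by (simp add: lap_def)
  have "(\<integral>\<omega>. exp (- s * X 1 \<omega>) \<partial>M) < (\<integral>\<omega>. 1 \<partial>M)"
    using int pos assms by (intro integral_less_AE_space) (auto simp: emeasure_space_1 elim!: eventually_mono)
  then show "lap s < 1" by (simp add: lap_def prob_space)
qed

lemma laplace_S:
  assumes "s > 0"
  shows "integrable M (\<lambda>\<omega>. exp (- s * S n \<omega>))" "expectation (\<lambda>\<omega>. exp (- s * S n \<omega>)) = lap s ^ n"
proof -
  have prod: "exp (- s * S n \<omega>) = (\<Prod>i\<in>{1..n}. exp (- s * X i \<omega>))" for \<omega>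
    by (simp add: random_walk_def exp_sum[symmetric] sum_distrib_left sum_negf)
  have ind: "indep_vars (\<lambda>_. borel) (\<lambda>i \<omega>. exp (- s * X i \<omega>)) {1..n}"
    using indep_vars_subset[OF indep, of "{1..n}"]
    by (intro indep_vars_compose2[where Y = "\<lambda>_ x. exp (- s * x)" and M' = "\<lambda>_. borel"]) auto
  have int: "integrable M (\<lambda>\<omega>. exp (- s * X i \<omega>))" if "i \<in> {1..n}" for i
    using AE_X_pos assms X_measurable[of i] that
    by (intro integrable_const_bound[where B = 1]) (auto elim!: eventually_mono)
  have "expectation (\<lambda>\<omega>. exp (- s * X i \<omega>)) = lap s" if "i \<in> {1..n}" for i
  proof -
    have "expectation (\<lambda>\<omega>. exp (- s * X i \<omega>)) = (\<integral>x. exp (- s * x) \<partial>distr M borel (X i))"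
      using X_measurable[of i] that by (subst integral_distr) auto
    also have "\<dots> = (\<integral>x. exp (- s * x) \<partial>distr M borel (X 1))" using ident[of i] that by auto
    also have "\<dots> = lap s" unfolding lap_def by (subst integral_distr) auto
    finally show ?thesis .
  qed
  then have "(\<Prod>i\<in>{1..n}. expectation (\<lambda>\<omega>. exp (- s * X i \<omega>))) = lap s ^ n"
    by (subst prod.cong[OF refl]) auto
  then show "integrable M (\<lambda>\<omega>. exp (- s * S n \<omega>))" "expectation (\<lambda>\<omega>. exp (- s * S n \<omega>)) = lap s ^ n"
    unfolding prod using indep_vars_integrable[OF _ ind int] indep_vars_lebesgue_integral[OF _ ind int]
    by simp_all
qed

text \<open>Chernoff bound: Markov's inequality for exp(-s S n). Its geometric decay in n yields
  both the unboundedness of the walk and the finiteness of \<open>pgf\<close>.\<close>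

lemma prob_S_le:
  assumes "s > 0"
  shows "prob {\<omega> \<in> space M. S n \<omega> \<le> v} \<le> exp (s * v) * lap s ^ n"
proof -
  have "prob {\<omega> \<in> space M. S n \<omega> \<le> v} = prob {\<omega> \<in> space M. exp (- s * v) \<le> exp (- s * S n \<omega>)}"
    using assms by (auto intro!: arg_cong[where f = prob])
  also have "\<dots> \<le> expectation (\<lambda>\<omega>. exp (- s * S n \<omega>)) / exp (- s * v)"
    using laplace_S[OF assms] by (intro integral_Markov_inequality_measure[where A = "{}"]) auto
  also have "\<dots> = exp (s * v) * lap s ^ n"
    unfolding laplace_S(2)[OF assms] by (simp add: exp_minus field_simps)
  finally show ?thesis .
qed

text \<open>By \<open>prob_S_le\<close> with s = 1, the walk stays below m forever with probability
  at most exp m times the n-th power of lap 1, for every n, hence with probability 0. This confines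
  the empty set in the infimum of \<open>first_passage\<close> to a null set.\<close>

lemma AE_S_unbounded: "AE \<omega> in M. \<forall>v. \<exists>n. S n \<omega> > v"
proof -
  have "AE \<omega> in M. \<exists>n. S n \<omega> > real m" for m :: nat
  proof (rule AE_I[where N = "{\<omega> \<in> space M. \<forall>n. S n \<omega> \<le> real m}"])
    have "prob {\<omega> \<in> space M. \<forall>n. S n \<omega> \<le> real m} \<le> exp (real m) * lap 1 ^ n" for n
      using finite_measure_mono[of "{\<omega> \<in> space M. \<forall>n. S n \<omega> \<le> real m}" "{\<omega> \<in> space M. S n \<omega> \<le> real m}"]
        prob_S_le[of 1 n "real m"] by (force intro: order_trans)
    moreover have "(\<lambda>n. exp (real m) * lap 1 ^ n) \<longlonglongrightarrow> exp (real m) * 0"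
      using lap_bounds[of 1] by (intro tendsto_intros LIMSEQ_power_zero) auto
    ultimately have "prob {\<omega> \<in> space M. \<forall>n. S n \<omega> \<le> real m} \<le> 0"
      by (intro LIMSEQ_le_const[where X = "\<lambda>n. exp (real m) * lap 1 ^ n"]) auto
    then show "emeasure M {\<omega> \<in> space M. \<forall>n. S n \<omega> \<le> real m} = 0"
      by (simp add: emeasure_eq_measure measure_le_0_iff)
  qed (auto simp: not_less)
  then have "AE \<omega> in M. \<forall>m. \<exists>n. S n \<omega> > real m" by (simp add: AE_all_countable)
  then show ?thesis
  proof eventually_elim
    case (elim \<omega>)
    show ?case
    proof
      fix v
      obtain m where "v \<le> real m" using real_arch_simple by blast
      moreover obtain n where "S n \<omega> > real m" using elim by blast
      ultimately show "\<exists>n. S n \<omega> > v" by (meson order_le_less_trans)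
    qed
  qed
qed

lemma AE_good: "AE \<omega> in M. (\<forall>i\<ge>1. X i \<omega> > 0) \<and> (\<forall>v. \<exists>n\<ge>1. S n \<omega> > v)"
  using AE_X_pos AE_S_unbounded
proof eventually_elim
  case (elim \<omega>)
  have "\<exists>n\<ge>1. S n \<omega> > v" for v
  proof -
    \<comment> \<open>Exceeding max v 0 rules out n = 0, since S 0 = 0, and
      \<open>first_passage\<close> looks only at n \<ge> 1.\<close>
    obtain n where n: "S n \<omega> > max v 0" using elim(2) by blast
    then have "n \<noteq> 0" by (intro notI) auto
    then show ?thesis using n by (intro exI[of _ n]) auto
  qed
  with elim show ?case by auto
qed

lemma first_passage_props:
  assumes "\<exists>n\<ge>1. S n \<omega> > v"
  shows "N v \<omega> \<ge> 1" "S (N v \<omega>) \<omega> > v" "\<And>k. k \<ge> 1 \<Longrightarrow> S k \<omega> > v \<Longrightarrow> N v \<omega> \<le> k"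
proof -
  have "N v \<omega> \<in> {k. k \<ge> 1 \<and> S k \<omega> > v}"
    unfolding first_passage_def by (rule Inf_nat_def1) (use assms in auto)
  then show "N v \<omega> \<ge> 1" "S (N v \<omega>) \<omega> > v" by auto
  show "N v \<omega> \<le> k" if "k \<ge> 1" "S k \<omega> > v" for k
    unfolding first_passage_def by (rule wellorder_Inf_le1) (use that in auto)
qed

lemma first_passage_eq_iff:
  assumes good: "(\<forall>i\<ge>1. X i \<omega> > 0) \<and> (\<forall>v. \<exists>n\<ge>1. S n \<omega> > v)" and v: "v \<ge> 0"
  shows "N v \<omega> = Suc n \<longleftrightarrow> S n \<omega> \<le> v \<and> v < S (Suc n) \<omega>"
proof -
  have mono: "S m \<omega> \<le> S k \<omega>" if "m \<le> k" for m k
  proof (rule lift_Suc_mono_le[OF _ that])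
    show "S i \<omega> \<le> S (Suc i) \<omega>" for i using good by (auto simp: S_Suc intro: less_imp_le)
  qed
  note fp = first_passage_props[OF good[THEN conjunct2, rule_format, of v]]
  show ?thesis
  proof
    assume eq: "N v \<omega> = Suc n"
    have "S n \<omega> \<le> v"
    proof (rule ccontr)
      assume "\<not> S n \<omega> \<le> v"
      \<comment> \<open>For n = 0 the inequality is S 0 = 0 \<le> v; for n \<ge> 1 a violation would
        contradict the minimality of the passage index n + 1.\<close>
      then have "n \<noteq> 0" using v by (intro notI) auto
      then show False using fp(3)[of n] eq \<open>\<not> S n \<omega> \<le> v\<close> by auto
    qed
    with fp(2) eq show "S n \<omega> \<le> v \<and> v < S (Suc n) \<omega>" by auto
  next
    assume *: "S n \<omega> \<le> v \<and> v < S (Suc n) \<omega>"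
    have "N v \<omega> \<le> Suc n" using fp(3)[of "Suc n"] * by auto
    moreover have "\<not> N v \<omega> \<le> n" using fp(2) mono[of "N v \<omega>" n] * by auto
    ultimately show "N v \<omega> = Suc n" by auto
  qed
qed

section \<open>Generating functions of the first passage time and their Laplace transforms\<close>

lemma pgf_eq_suminf:
  assumes "z \<ge> 0" "v \<ge> 0"
  shows "pgf z v = (\<Sum>n. ennreal (z ^ Suc n) * emeasure M {\<omega> \<in> space M. S n \<omega> \<le> v \<and> v < S (Suc n) \<omega>})"
proof -
  have "pgf z v = (\<integral>\<^sup>+\<omega>. (\<Sum>n. ennreal (z ^ Suc n) * indicator {\<omega> \<in> space M. S n \<omega> \<le> v \<and> v < S (Suc n) \<omega>} \<omega>) \<partial>M)"
    unfolding pgf_def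
  proof (rule nn_integral_cong_AE)
    show "AE \<omega> in M. ennreal (z ^ N v \<omega>) =
        (\<Sum>n. ennreal (z ^ Suc n) * indicator {\<omega> \<in> space M. S n \<omega> \<le> v \<and> v < S (Suc n) \<omega>} \<omega>)"
      using AE_good AE_space
    proof eventually_elim
      case (elim \<omega>)
      obtain m where m: "N v \<omega> = Suc m"
        using first_passage_props(1)[of v \<omega>] elim(1) by (cases "N v \<omega>") auto
      have "(\<Sum>n. ennreal (z ^ Suc n) * indicator {\<omega> \<in> space M. S n \<omega> \<le> v \<and> v < S (Suc n) \<omega>} \<omega>)
          = (\<Sum>n\<in>{m}. ennreal (z ^ Suc n) * indicator {\<omega> \<in> space M. S n \<omega> \<le> v \<and> v < S (Suc n) \<omega>} \<omega>)"
        by (rule suminf_finite)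
          (use first_passage_eq_iff[OF elim(1) assms(2), symmetric] m in \<open>simp_all add: indicator_def\<close>)
      also have "\<dots> = ennreal (z ^ N v \<omega>)"
        using first_passage_eq_iff[OF elim(1) assms(2), of m] m elim(2) by (auto simp: indicator_def)
      finally show ?case by simp
    qed
  qed
  also have "\<dots> = (\<Sum>n. ennreal (z ^ Suc n) * emeasure M {\<omega> \<in> space M. S n \<omega> \<le> v \<and> v < S (Suc n) \<omega>})"
    by (subst nn_integral_suminf) (auto simp: nn_integral_cmult_indicator)
  finally show ?thesis .
qed

lemma pgf_finite:
  assumes "z \<ge> 0" "v \<ge> 0" "s > 0" "z * lap s < 1"
  shows "pgf z v < \<infinity>"
proof -
  have "pgf z v \<le> (\<Sum>n. ennreal (z * exp (s * v) * (z * lap s) ^ n))"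
    unfolding pgf_eq_suminf[OF assms(1,2)]
  proof (rule suminf_le)
    fix n
    have "emeasure M {\<omega> \<in> space M. S n \<omega> \<le> v \<and> v < S (Suc n) \<omega>} \<le> emeasure M {\<omega> \<in> space M. S n \<omega> \<le> v}"
      by (intro emeasure_mono) auto
    also have "\<dots> \<le> ennreal (exp (s * v) * lap s ^ n)"
      using prob_S_le[OF assms(3)] by (simp add: emeasure_eq_measure ennreal_leI)
    finally have "ennreal (z ^ Suc n) * emeasure M {\<omega> \<in> space M. S n \<omega> \<le> v \<and> v < S (Suc n) \<omega>}
        \<le> ennreal (z ^ Suc n) * ennreal (exp (s * v) * lap s ^ n)"
      by (rule mult_left_mono) simp
    also have "\<dots> = ennreal (z * exp (s * v) * (z * lap s) ^ n)"
      using assms(1) lap_bounds(1)[OF assms(3)]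
      by (simp add: ennreal_mult[symmetric] power_mult_distrib mult_ac)
    finally show "ennreal (z ^ Suc n) * emeasure M {\<omega> \<in> space M. S n \<omega> \<le> v \<and> v < S (Suc n) \<omega>} \<le> \<dots>" .
  qed auto
  also have "\<dots> = ennreal (\<Sum>n. z * exp (s * v) * (z * lap s) ^ n)"
    using assms lap_bounds(1)[OF assms(3)]
    by (intro suminf_ennreal2 summable_mult summable_geometric) (auto intro!: mult_nonneg_nonneg zero_le_power)
  finally show ?thesis by (auto simp: less_top[symmetric] top_unique)
qed

lemma AE_first_passage_mono: "u \<le> v \<Longrightarrow> AE \<omega> in M. N u \<omega> \<le> N v \<omega>"
  using AE_good
proof eventually_elim
  case (elim \<omega>)
  then have ex: "\<exists>n\<ge>1. S n \<omega> > w" for w by blast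
  show ?case
    using first_passage_props(1,2)[OF ex[of v]] elim(1) by (intro first_passage_props(3)[OF ex[of u]]) auto
qed

lemma pgf_mono:
  assumes "z \<ge> 1" "u \<le> v" shows "pgf z u \<le> pgf z v"
  unfolding pgf_def using AE_first_passage_mono[OF assms(2)]
  by (intro nn_integral_mono_AE) (auto elim!: eventually_mono intro!: ennreal_leI power_increasing assms)

lemma pgf_antimono:
  assumes "0 \<le> z" "z \<le> 1" "u \<le> v" shows "pgf z v \<le> pgf z u"
  unfolding pgf_def using AE_first_passage_mono[OF assms(3)]
  by (intro nn_integral_mono_AE) (auto elim!: eventually_mono intro!: ennreal_leI power_decreasing assms)

lemma pgf_le_1:
  assumes "0 \<le> z" "z \<le> 1" shows "pgf z v \<le> 1"
proof -
  have "pgf z v \<le> (\<integral>\<^sup>+\<omega>. 1 \<partial>M)"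
    unfolding pgf_def using assms by (intro nn_integral_mono) (auto intro!: ennreal_le_1[THEN iffD2] power_le_one)
  then show ?thesis by (simp add: emeasure_space_1)
qed

text \<open>By Tonelli the level v is integrated first. The exponential law gives [S n, S (n + 1))
  the mass exp(-s S n) - exp(-s S (n + 1)), whose mean is the n-th power of lap s times 1 - lap s.
  Summing these with the weights z ^ (n + 1) is a geometric series.\<close>

lemma laplace_pgf:
  assumes z: "z \<ge> 0" and s: "s > 0" and zs: "z * lap s < 1"
  shows "(\<integral>\<^sup>+v. pgf z v \<partial>exp_law s) = ennreal (z * (1 - lap s) / (1 - z * lap s))"
proof -
  interpret E: prob_space "exp_law s" by (rule prob_space_exp_law[OF s])
  interpret P: pair_sigma_finite "exp_law s" M by standard
  let ?I = "\<lambda>n v \<omega>. (if S n \<omega> \<le> v \<and> v < S (Suc n) \<omega> then 1 else 0) :: ennreal"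
  have inner: "(\<integral>\<^sup>+v. \<integral>\<^sup>+\<omega>. ?I n v \<omega> \<partial>M \<partial>exp_law s) = ennreal (lap s ^ n * (1 - lap s))" for n
  proof -
    have "(\<integral>\<^sup>+v. \<integral>\<^sup>+\<omega>. ?I n v \<omega> \<partial>M \<partial>exp_law s) = (\<integral>\<^sup>+\<omega>. \<integral>\<^sup>+v. ?I n v \<omega> \<partial>exp_law s \<partial>M)"
      by (rule P.Fubini'[symmetric]) measurable
    also have "\<dots> = (\<integral>\<^sup>+\<omega>. ennreal (exp (- s * S n \<omega>) - exp (- s * S (Suc n) \<omega>)) \<partial>M)"
    proof (rule nn_integral_cong_AE)
      show "AE \<omega> in M. (\<integral>\<^sup>+v. ?I n v \<omega> \<partial>exp_law s) = ennreal (exp (- s * S n \<omega>) - exp (- s * S (Suc n) \<omega>))"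
        using AE_X_pos
      proof eventually_elim
        case (elim \<omega>)
        have "S n \<omega> \<ge> 0" unfolding random_walk_def using elim by (intro sum_nonneg) (auto intro: less_imp_le)
        moreover have "S n \<omega> \<le> S (Suc n) \<omega>" using elim by (auto simp: S_Suc intro: less_imp_le)
        moreover have "(\<integral>\<^sup>+v. ?I n v \<omega> \<partial>exp_law s) = (\<integral>\<^sup>+v. indicator {S n \<omega>..<S (Suc n) \<omega>} v \<partial>exp_law s)"
          by (intro nn_integral_cong) (auto simp: indicator_def)
        ultimately show ?case using s by (simp add: emeasure_exp_law_atLeastLessThan)
      qed
    qed
    also have "\<dots> = ennreal (expectation (\<lambda>\<omega>. exp (- s * S n \<omega>) - exp (- s * S (Suc n) \<omega>)))"
    proof (rule nn_integral_eq_integral)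
      show "integrable M (\<lambda>\<omega>. exp (- s * S n \<omega>) - exp (- s * S (Suc n) \<omega>))"
        by (intro Bochner_Integration.integrable_diff laplace_S s)
      show "AE \<omega> in M. 0 \<le> exp (- s * S n \<omega>) - exp (- s * S (Suc n) \<omega>)"
        using AE_X_pos s by (auto elim!: eventually_mono simp: S_Suc less_imp_le)
    qed
    also have "expectation (\<lambda>\<omega>. exp (- s * S n \<omega>) - exp (- s * S (Suc n) \<omega>)) = lap s ^ n * (1 - lap s)"
      unfolding Bochner_Integration.integral_diff[OF laplace_S(1)[OF s] laplace_S(1)[OF s]]
        laplace_S(2)[OF s] by (simp add: right_diff_distrib)
    finally show ?thesis .
  qed
  have "(\<integral>\<^sup>+v. pgf z v \<partial>exp_law s) = (\<integral>\<^sup>+v. (\<Sum>n. ennreal (z ^ Suc n) * (\<integral>\<^sup>+\<omega>. ?I n v \<omega> \<partial>M)) \<partial>exp_law s)"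
  proof (rule nn_integral_cong_AE)
    have *: "(\<integral>\<^sup>+\<omega>. ?I n v \<omega> \<partial>M) = emeasure M {\<omega> \<in> space M. S n \<omega> \<le> v \<and> v < S (Suc n) \<omega>}" for n v
    proof -
      have "(\<integral>\<^sup>+\<omega>. ?I n v \<omega> \<partial>M) = (\<integral>\<^sup>+\<omega>. indicator {\<omega> \<in> space M. S n \<omega> \<le> v \<and> v < S (Suc n) \<omega>} \<omega> \<partial>M)"
        by (intro nn_integral_cong) (auto simp: indicator_def)
      then show ?thesis by simp
    qed
    show "AE v in exp_law s. pgf z v = (\<Sum>n. ennreal (z ^ Suc n) * (\<integral>\<^sup>+\<omega>. ?I n v \<omega> \<partial>M))"
      unfolding * using AE_exp_law_pos[of s] by eventually_elim (simp add: pgf_eq_suminf z)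
  qed
  also have "\<dots> = (\<Sum>n. ennreal (z ^ Suc n) * (\<integral>\<^sup>+v. \<integral>\<^sup>+\<omega>. ?I n v \<omega> \<partial>M \<partial>exp_law s))"
    by (subst nn_integral_suminf) (auto simp: nn_integral_cmult)
  also have "\<dots> = (\<Sum>n. ennreal (z * (1 - lap s) * (z * lap s) ^ n))"
    unfolding inner using z lap_bounds[OF s]
    by (intro suminf_cong) (simp add: ennreal_mult[symmetric] power_mult_distrib mult_ac)
  also have "\<dots> = ennreal (\<Sum>n. z * (1 - lap s) * (z * lap s) ^ n)"
    using z zs lap_bounds[OF s]
    by (intro suminf_ennreal2 summable_mult summable_geometric) (auto intro!: mult_nonneg_nonneg zero_le_power)
  also have "(\<Sum>n. z * (1 - lap s) * (z * lap s) ^ n) = z * (1 - lap s) / (1 - z * lap s)"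
    using z zs lap_bounds[OF s] by (subst suminf_mult) (auto simp: suminf_geometric summable_geometric)
  finally show ?thesis .
qed

text \<open>Tonelli again: 1 - exp(-s X 1) is the mass of [0, X 1) under the exponential law.
  Writing 1 - lap s as a transform of \<open>tail\<close> is what lets the regular variation of the
  tail reach the Laplace transform of the steps.\<close>

lemma one_minus_lap:
  assumes s: "s > 0"
  shows "1 - lap s = (\<integral>v. tail v \<partial>exp_law s)"
proof -
  interpret E: prob_space "exp_law s" by (rule prob_space_exp_law[OF s])
  interpret P: pair_sigma_finite "exp_law s" M by standard
  let ?I = "\<lambda>v \<omega>. (if v < X 1 \<omega> then 1 else 0) :: ennreal"
  have [measurable]: "tail \<in> borel_measurable borel"
  proof -
    have "mono (\<lambda>t. - tail t)" unfolding tail_def by (intro monoI) (auto intro!: finite_measure_mono)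
    then have "(\<lambda>t. - tail t) \<in> borel_measurable borel" by (rule borel_measurable_mono)
    then show ?thesis by simp
  qed
  have "(\<integral>\<^sup>+v. ennreal (tail v) \<partial>exp_law s) = (\<integral>\<^sup>+v. \<integral>\<^sup>+\<omega>. ?I v \<omega> \<partial>M \<partial>exp_law s)"
  proof (rule nn_integral_cong)
    fix v
    have "(\<integral>\<^sup>+\<omega>. ?I v \<omega> \<partial>M) = (\<integral>\<^sup>+\<omega>. indicator {\<omega> \<in> space M. v < X 1 \<omega>} \<omega> \<partial>M)"
      by (intro nn_integral_cong) (auto simp: indicator_def)
    then show "ennreal (tail v) = (\<integral>\<^sup>+\<omega>. ?I v \<omega> \<partial>M)" by (simp add: tail_def emeasure_eq_measure)
  qed
  also have "\<dots> = (\<integral>\<^sup>+\<omega>. \<integral>\<^sup>+v. ?I v \<omega> \<partial>exp_law s \<partial>M)"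
    by (rule P.Fubini'[symmetric]) measurable
  also have "\<dots> = (\<integral>\<^sup>+\<omega>. ennreal (1 - exp (- s * X 1 \<omega>)) \<partial>M)"
  proof (rule nn_integral_cong_AE)
    show "AE \<omega> in M. (\<integral>\<^sup>+v. ?I v \<omega> \<partial>exp_law s) = ennreal (1 - exp (- s * X 1 \<omega>))"
      using pos
    proof eventually_elim
      case (elim \<omega>)
      have "(\<integral>\<^sup>+v. ?I v \<omega> \<partial>exp_law s) = (\<integral>\<^sup>+v. indicator {0..<X 1 \<omega>} v \<partial>exp_law s)"
        using AE_exp_law_pos[of s]
        by (intro nn_integral_cong_AE, eventually_elim) (auto simp: indicator_def)
      then show ?case using s elim by (simp add: emeasure_exp_law_atLeastLessThan)
    qed
  qed
  also have "\<dots> = ennreal (expectation (\<lambda>\<omega>. 1 - exp (- s * X 1 \<omega>)))"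
    using pos s by (intro nn_integral_eq_integral integrable_const_bound[where B = 1])
      (auto elim!: eventually_mono)
  also have "expectation (\<lambda>\<omega>. 1 - exp (- s * X 1 \<omega>)) = 1 - lap s"
    using laplace_S(1)[OF s, of 1] unfolding lap_def
    by (subst Bochner_Integration.integral_diff) (auto simp: prob_space random_walk_def)
  finally have "(\<integral>\<^sup>+v. ennreal (tail v) \<partial>exp_law s) = ennreal (1 - lap s)" .
  then show ?thesis using lap_bounds[OF s]
    by (subst integral_eq_nn_integral) (auto simp: tail_def)
qed

text \<open>\<open>enn2real\<close> sends infinity to 0, so the value is meaningful only where
  \<open>pgf\<close> is finite; \<open>pgf_eq_real_pgf\<close> provides this.\<close>

definition real_pgf :: "real \<Rightarrow> real \<Rightarrow> real" where
  "real_pgf z v = enn2real (pgf z v)"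

lemma real_pgf_nonneg [simp]: "0 \<le> real_pgf z v"
  by (simp add: real_pgf_def)

lemma pgf_eq_real_pgf:
  assumes "z \<ge> 0" "s > 0" "z * lap s < 1"
  shows "pgf z v = ennreal (real_pgf z v)"
proof -
  have "pgf z v < \<infinity>"
  proof (cases "z \<ge> 1")
    case True
    \<comment> \<open>The geometric bound of \<open>pgf_finite\<close> is available for nonnegative
      levels; monotonicity covers negative v.\<close>
    have "pgf z v \<le> pgf z (max 0 v)" by (intro pgf_mono True) simp
    also have "\<dots> < \<infinity>" by (intro pgf_finite[OF assms(1) _ assms(2,3)]) simp
    finally show ?thesis .
  next
    case False
    then show ?thesis using pgf_le_1[of z v] assms(1) by (auto intro: order_le_less_trans[OF _ ennreal_one_less_top])
  qed
  then show ?thesis by (simp add: real_pgf_def)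
qed

lemma real_pgf_mono:
  assumes "z \<ge> 1" "s > 0" "z * lap s < 1" "u \<le> v"
  shows "real_pgf z u \<le> real_pgf z v"
proof -
  have z: "0 \<le> z" using assms(1) by simp
  from pgf_mono[OF assms(1,4)] show ?thesis unfolding pgf_eq_real_pgf[OF z assms(2,3)] by simp
qed

lemma real_pgf_antimono:
  assumes "0 \<le> z" "z \<le> 1" "u \<le> v"
  shows "real_pgf z v \<le> real_pgf z u"
  unfolding real_pgf_def using pgf_antimono[OF assms] pgf_le_1[OF assms(1,2), of u]
  by (intro enn2real_mono) (auto intro: order_le_less_trans[OF _ ennreal_one_less_top])

lemma real_pgf_le_1: "0 \<le> z \<Longrightarrow> z \<le> 1 \<Longrightarrow> real_pgf z v \<le> 1"
  unfolding real_pgf_def using pgf_le_1[of z v] by (intro enn2real_leI) auto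

lemma real_pgf_measurable:
  assumes "z \<ge> 0" "s > 0" "z * lap s < 1"
  shows "real_pgf z \<in> borel_measurable borel"
proof (cases "z \<ge> 1")
  case True
  then show ?thesis
    by (intro borel_measurable_mono monoI real_pgf_mono[OF True assms(2,3)])
next
  case False
  then have "(\<lambda>v. - real_pgf z v) \<in> borel_measurable borel"
    using assms(1) by (intro borel_measurable_mono monoI le_imp_neg_le real_pgf_antimono) auto
  then show ?thesis by simp
qed

lemma real_pgf_laplace:
  assumes z: "z \<ge> 0" and s: "s > 0" and t: "t > 0" and zs: "z * lap (s / t) < 1"
  shows "integrable (exp_law s) (\<lambda>u. real_pgf z (t * u))"
    and "(\<integral>u. real_pgf z (t * u) \<partial>exp_law s) = z * (1 - lap (s / t)) / (1 - z * lap (s / t))"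
proof -
  have st: "s / t > 0" using s t by simp
  note [measurable] = real_pgf_measurable[OF z st zs]
  have "(\<integral>\<^sup>+u. ennreal (real_pgf z (t * u)) \<partial>exp_law s) = (\<integral>\<^sup>+u. ennreal (real_pgf z u) \<partial>exp_law (s / t))"
    by (rule nn_integral_exp_law_scale[OF s t]) measurable
  also have "\<dots> = (\<integral>\<^sup>+u. pgf z u \<partial>exp_law (s / t))" by (simp add: pgf_eq_real_pgf[OF z st zs])
  also have "\<dots> = ennreal (z * (1 - lap (s / t)) / (1 - z * lap (s / t)))"
    by (rule laplace_pgf[OF z st zs])
  finally have *: "(\<integral>\<^sup>+u. ennreal (real_pgf z (t * u)) \<partial>exp_law s) = ennreal (z * (1 - lap (s / t)) / (1 - z * lap (s / t)))" .
  then show "integrable (exp_law s) (\<lambda>u. real_pgf z (t * u))"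
    by (intro integrableI_nonneg) auto
  show "(\<integral>u. real_pgf z (t * u) \<partial>exp_law s) = z * (1 - lap (s / t)) / (1 - z * lap (s / t))"
    using lap_bounds[OF st] z zs by (subst integral_eq_nn_integral) (auto simp: * enn2real_ennreal)
qed

lemma tail_antimono: "u \<le> v \<Longrightarrow> tail v \<le> tail u"
  unfolding tail_def by (intro finite_measure_mono) auto

lemma tail_le_1: "tail v \<le> 1" and tail_nonneg: "0 \<le> tail v"
  by (auto simp: tail_def)

lemma tail_measurable [measurable]: "tail \<in> borel_measurable borel"
proof -
  have "(\<lambda>t. - tail t) \<in> borel_measurable borel"
    by (intro borel_measurable_mono monoI le_imp_neg_le tail_antimono)
  then show ?thesis by simp
qed

lemma tail_tendsto_0: "(tail \<longlongrightarrow> 0) at_top"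
proof -
  interpret D: real_distribution "distr M borel (X 1)" by simp
  have "tail = (\<lambda>t. 1 - cdf (distr M borel (X 1)) t)"
  proof
    fix t
    have "cdf (distr M borel (X 1)) t = prob {\<omega> \<in> space M. X 1 \<omega> \<le> t}"
      by (simp add: cdf_def2 measure_distr vimage_def Int_def conj_commute)
    also have "\<dots> = 1 - tail t"
      unfolding tail_def by (subst prob_compl[symmetric]) (auto intro!: arg_cong[where f = prob])
    finally show "tail t = 1 - cdf (distr M borel (X 1)) t" by simp
  qed
  moreover have "((\<lambda>t. 1 - cdf (distr M borel (X 1)) t) \<longlongrightarrow> 1 - 1) at_top"
    by (intro tendsto_intros D.cdf_lim_at_top_prob)
  ultimately show ?thesis by (simp only: diff_self)
qed

end

section \<open>Regularly varying tails: Abelian asymptotics and the Tauberian limit\<close>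

locale regularly_varying_walk = positive_iid_walk +
  fixes \<alpha> :: real
  assumes alpha: "0 \<le> \<alpha>" "\<alpha> < 1"
    and tail_pos: "\<And>t. tail t > 0"
    and tail_ratio: "\<And>x. x > 0 \<Longrightarrow> ((\<lambda>t. tail (x * t) / tail t) \<longlongrightarrow> x powr - \<alpha>) at_top"
begin

text \<open>A Potter bound. Monotonicity of the tail reduces it to the behaviour of the ratio under halving
  of the argument, so no uniform convergence theorem is needed.\<close>

lemma potter_bound:
  assumes "\<alpha> < \<beta>"
  shows "\<exists>C. \<exists>T>0. \<forall>t\<ge>T. \<forall>v. 0 < v \<longrightarrow> v \<le> 1 \<longrightarrow> tail (v * t) / tail t \<le> C * v powr - \<beta>"
proof -
  have \<beta>: "\<beta> > 0" using assms alpha by simp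
  have "((\<lambda>t. tail (1 / 2 * t) / tail t) \<longlongrightarrow> (1 / 2) powr - \<alpha>) at_top"
    by (rule tail_ratio) simp
  \<comment> \<open>The halving ratio has the limit 2 powr \<alpha>, strictly below 2 powr \<beta>;
    this is the room gained by taking \<beta> > \<alpha>.\<close>
  moreover have "(1 / 2) powr - \<alpha> < (2 :: real) powr \<beta>"
    using assms by (simp add: powr_minus_divide powr_divide)
  ultimately have "\<forall>\<^sub>F t in at_top. tail (1 / 2 * t) / tail t < 2 powr \<beta>"
    by (rule order_tendstoD)
  then obtain T0 where T0: "\<And>t. t \<ge> T0 \<Longrightarrow> tail (1 / 2 * t) / tail t < 2 powr \<beta>"
    by (auto simp: eventually_at_top_linorder)
  define T where "T = max 1 T0"
  have T: "T > 0" by (simp add: T_def)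
  have half: "tail (t / 2) \<le> 2 powr \<beta> * tail t" if "t \<ge> T" for t
    using T0[of t] that tail_pos[of t] by (simp add: T_def field_simps)
  \<comment> \<open>Induction on the number of halvings that lead from 1 down to v. A halving costs
    2 powr \<beta>, which (2 * v) powr - \<beta> absorbs exactly; the leading 2 powr \<beta> pays
    for the last, incomplete halving. The condition T \<le> v * t keeps every argument in the range
    of \<open>half\<close>.\<close>
  have ind: "tail (v * t) \<le> 2 powr \<beta> * v powr - \<beta> * tail t"
    if "t \<ge> T" "(1 / 2) ^ n \<le> v" "v \<le> 1" "T \<le> v * t" for n v t
    using that
  proof (induction n arbitrary: v)
    case 0
    have "1 * tail t \<le> 2 powr \<beta> * tail t"
      using \<beta> tail_nonneg by (intro mult_right_mono ge_one_powr_ge_zero) auto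
    with 0 show ?case by simp
  next
    case (Suc n)
    show ?case
    proof (cases "v \<ge> 1 / 2")
      case True
      have "tail (v * t) \<le> tail (t / 2)"
        using mult_right_mono[OF True, of t] T Suc.prems(1) by (intro tail_antimono) auto
      also have "\<dots> \<le> 2 powr \<beta> * 1 * tail t" using half[OF Suc.prems(1)] by simp
      also have "\<dots> \<le> 2 powr \<beta> * v powr - \<beta> * tail t"
        using True Suc.prems \<beta> tail_nonneg powr_mono2'[of "- \<beta>" v 1]
        by (intro mult_right_mono mult_left_mono) auto
      finally show ?thesis .
    next
      case False
      have v: "v > 0" using Suc.prems(2) by (rule less_le_trans[rotated]) simp
      have "2 * v * t \<ge> v * t" using v T Suc.prems(1) by simp
      then have "T \<le> 2 * v * t" using Suc.prems(4) by linarith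
      have "tail (v * t) = tail ((2 * v * t) / 2)" by simp
      also have "\<dots> \<le> 2 powr \<beta> * tail ((2 * v) * t)"
        using half[OF \<open>T \<le> 2 * v * t\<close>] by simp
      also have "\<dots> \<le> 2 powr \<beta> * (2 powr \<beta> * (2 * v) powr - \<beta> * tail t)"
        using Suc False \<open>T \<le> 2 * v * t\<close> by (intro mult_left_mono Suc.IH) auto
      also have "\<dots> = 2 powr \<beta> * v powr - \<beta> * tail t"
        using v by (simp add: powr_mult powr_minus)
      finally show ?thesis .
    qed
  qed
  have big: "tail (v * t) \<le> 2 powr \<beta> * v powr - \<beta> * tail t"
    if "t \<ge> T" "0 < v" "v \<le> 1" "T \<le> v * t" for v t
  proof -
    from that(2) obtain n where "(1 / 2) ^ n < v" using real_arch_pow_inv[of v "1 / 2"] by auto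
    then show ?thesis using ind[of t n v] that by simp
  qed
  \<comment> \<open>Below the threshold, v * t < T, only tail (v * t) \<le> 1 is available. There
    the bound at v = T / t compares tail T with tail t, and dividing by tail T gives this constant;
    it also dominates 2 powr \<beta> because tail T \<le> 1.\<close>
  define C where "C = 2 powr \<beta> / tail T"
  have "tail (v * t) / tail t \<le> C * v powr - \<beta>" if "t \<ge> T" "0 < v" "v \<le> 1" for t v
  proof (cases "T \<le> v * t")
    case True
    have "2 powr \<beta> * 1 \<le> 2 powr \<beta> * (1 / tail T)"
      using tail_pos[of T] tail_le_1[of T] by (intro mult_left_mono) auto
    then have "2 powr \<beta> \<le> C" by (simp add: C_def)
    then have "2 powr \<beta> * (v powr - \<beta>) \<le> C * v powr - \<beta>" by (rule mult_right_mono) simp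
    moreover have "tail (v * t) / tail t \<le> 2 powr \<beta> * v powr - \<beta>"
      using big[OF that True] tail_pos[of t] by (simp add: pos_divide_le_eq)
    ultimately show ?thesis by linarith
  next
    case False
    have w: "T / t > 0" "T / t \<le> 1" "T / t * t = T" using that T by auto
    have vw: "v \<le> T / t" using False that T by (simp add: field_simps)
    have "tail T \<le> 2 powr \<beta> * (T / t) powr - \<beta> * tail t"
      using big[OF that(1) w(1,2)] w(3) by simp
    also have "\<dots> \<le> 2 powr \<beta> * v powr - \<beta> * tail t"
      using vw that \<beta> tail_nonneg powr_mono2'[of "- \<beta>" v "T / t"]
      by (intro mult_right_mono mult_left_mono) auto
    finally have "1 / tail t \<le> C * v powr - \<beta>"
      using tail_pos[of t] tail_pos[of T] by (simp add: C_def field_simps)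
    moreover have "tail (v * t) / tail t \<le> 1 / tail t"
      using tail_pos[of t] tail_le_1 by (intro divide_right_mono) auto
    ultimately show ?thesis by linarith
  qed
  then show ?thesis using T by blast
qed

text \<open>By \<open>one_minus_lap\<close> and rescaling, the quotient is the mean of tail (t u) /
  tail t under the standard exponential law. The integrand tends to u powr - \<alpha>, with mean
  Gamma (1 - \<alpha>). It is dominated by 1 for u > 1, by monotonicity, and by C * u powr - \<beta>
  for u \<le> 1, by \<open>potter_bound\<close>; \<beta> is taken between \<alpha> and 1 to make
  this integrable at 0.\<close>

lemma lap_ratio_1: "((\<lambda>t. (1 - lap (1 / t)) / tail t) \<longlongrightarrow> Gamma (1 - \<alpha>)) at_top"
proof -
  define \<beta> where "\<beta> = (\<alpha> + 1) / 2"
  have \<beta>: "\<alpha> < \<beta>" "\<beta> < 1" using alpha by (auto simp: \<beta>_def)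
  obtain C T where CT: "T > 0" "\<And>t v. t \<ge> T \<Longrightarrow> 0 < v \<Longrightarrow> v \<le> 1 \<Longrightarrow> tail (v * t) / tail t \<le> C * v powr - \<beta>"
    using potter_bound[OF \<beta>(1)] by metis
  interpret E: prob_space "exp_law 1" by (rule prob_space_exp_law) simp
  have int: "integrable (exp_law 1) (\<lambda>u. u powr p)" "(\<integral>u. u powr p \<partial>exp_law 1) = Gamma (p + 1)" if "p > -1" for p
    using nn_integral_exp_law_powr[of 1 p] that
    by (auto intro!: integrableI_nonneg simp: integral_eq_nn_integral Gamma_real_nonneg)
  have "((\<lambda>t. \<integral>u. tail (t * u) / tail t \<partial>exp_law 1) \<longlongrightarrow> (\<integral>u. u powr - \<alpha> \<partial>exp_law 1)) at_top"
  proof (rule integral_dominated_convergence_at_top[where w = "\<lambda>u. 1 + C * u powr - \<beta>"])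
    show "integrable (exp_law 1) (\<lambda>u. 1 + C * u powr - \<beta>)" using int[of "- \<beta>"] \<beta> by simp
    show "AE u in exp_law 1. ((\<lambda>t. tail (t * u) / tail t) \<longlongrightarrow> u powr - \<alpha>) at_top"
      using AE_exp_law_pos[of 1] by eventually_elim (use tail_ratio in \<open>simp add: mult.commute\<close>)
    have C: "C \<ge> 0"
      using CT(2)[of T 1] tail_pos[of T] by simp
    show "\<forall>\<^sub>F t in at_top. AE u in exp_law 1. norm (tail (t * u) / tail t) \<le> 1 + C * u powr - \<beta>"
      using eventually_ge_at_top[of T]
    proof eventually_elim
      case (elim t)
      show ?case using AE_exp_law_pos[of 1]
      proof eventually_elim
        case (elim u)
        have "tail (t * u) / tail t \<le> 1 + C * u powr - \<beta>"
        proof (cases "u \<le> 1")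
          case True
          then show ?thesis using CT(2)[OF \<open>T \<le> t\<close> elim] by (simp add: mult.commute)
        next
          case False
          then have "tail (t * u) \<le> tail t" using \<open>T \<le> t\<close> CT(1) by (intro tail_antimono) simp
          then have "tail (t * u) / tail t \<le> 1" using tail_pos[of t] by simp
          moreover have "0 \<le> C * u powr - \<beta>" using C by simp
          ultimately show ?thesis by linarith
        qed
        then show ?case using tail_nonneg by simp
      qed
    qed
  qed measurable
  moreover have "\<forall>\<^sub>F t in at_top. (\<integral>u. tail (t * u) / tail t \<partial>exp_law 1) = (1 - lap (1 / t)) / tail t"
    using eventually_gt_at_top[of 0]
    by eventually_elim (simp add: one_minus_lap integral_exp_law_scale)
  ultimately show ?thesis using int[of "- \<alpha>"] alpha
    by (auto elim: Lim_transform_eventually simp: add.commute)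
qed

text \<open>Evaluation of \<open>lap_ratio_1\<close> at t / s; the correction tail (t / s) / tail t
  contributes s powr \<alpha>.\<close>

lemma lap_ratio:
  assumes s: "s > 0"
  shows "((\<lambda>t. (1 - lap (s / t)) / tail t) \<longlongrightarrow> Gamma (1 - \<alpha>) * s powr \<alpha>) at_top"
proof -
  have "filterlim (\<lambda>t. t / s) at_top at_top"
    using filterlim_tendsto_pos_mult_at_top[OF tendsto_const[of "1 / s"] _ filterlim_ident] s by simp
  from filterlim_compose[OF lap_ratio_1 this]
  have "((\<lambda>t. (1 - lap (s / t)) / tail (t / s)) \<longlongrightarrow> Gamma (1 - \<alpha>)) at_top" by simp
  moreover have "((\<lambda>t. tail (t / s) / tail t) \<longlongrightarrow> s powr \<alpha>) at_top"
    using tail_ratio[of "1 / s"] s by (simp add: powr_minus powr_divide)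
  ultimately have "((\<lambda>t. (1 - lap (s / t)) / tail (t / s) * (tail (t / s) / tail t)) \<longlongrightarrow> Gamma (1 - \<alpha>) * s powr \<alpha>) at_top"
    by (rule tendsto_mult)
  moreover have "(1 - lap (s / t)) / tail (t / s) * (tail (t / s) / tail t) = (1 - lap (s / t)) / tail t" for t
    using tail_pos[of "t / s"] by simp
  ultimately show ?thesis by (simp only:)
qed

text \<open>Numerator and denominator are divided by tail t. With \<phi> = lap (s / t), the identity
  1 - z \<phi> = (1 - \<phi>) - \<phi> (z - 1) splits the denominator into \<open>lap_ratio\<close>
  and a difference quotient of the exponential function. The condition on \<theta> makes the
  limiting denominator positive, and hence z \<phi> < 1 eventually.\<close>

lemma laplace_limit:
  fixes \<theta> :: real
  assumes s: "s > 0" and \<theta>: "\<theta> < Gamma (1 - \<alpha>) * s powr \<alpha>"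
  defines "z \<equiv> \<lambda>t. exp (\<theta> * tail t)"
  shows "\<forall>\<^sub>F t in at_top. z t * lap (s / t) < 1"
    and "((\<lambda>t. z t * (1 - lap (s / t)) / (1 - z t * lap (s / t))) \<longlongrightarrow>
        Gamma (1 - \<alpha>) * s powr \<alpha> / (Gamma (1 - \<alpha>) * s powr \<alpha> - \<theta>)) at_top"
proof -
  let ?G = "Gamma (1 - \<alpha>) * s powr \<alpha>"
  have zlim: "(z \<longlongrightarrow> 1) at_top"
    unfolding z_def using tendsto_exp[OF tendsto_mult[OF tendsto_const[of \<theta>] tail_tendsto_0]] by simp
  \<comment> \<open>The derivative of h \<mapsto> exp (\<theta> * h) at 0; it can be composed with
    \<open>tail\<close>, which tends to 0 without attaining it.\<close>
  have "((\<lambda>h. (exp (\<theta> * h) - 1) / h) \<longlongrightarrow> \<theta>) (at 0)"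
  proof -
    have "((\<lambda>h. exp (\<theta> * h)) has_field_derivative \<theta>) (at 0)"
      by (auto intro!: derivative_eq_intros)
    then show ?thesis by (simp add: has_field_derivative_iff)
  qed
  moreover have "filterlim tail (at 0) at_top"
    unfolding filterlim_at using tail_tendsto_0 by (auto simp: less_imp_neq[OF tail_pos, symmetric])
  ultimately have zr: "((\<lambda>t. (z t - 1) / tail t) \<longlongrightarrow> \<theta>) at_top"
    unfolding z_def by (rule filterlim_compose)
  have "((\<lambda>t. 1 - (1 - lap (s / t)) / tail t * tail t) \<longlongrightarrow> 1 - ?G * 0) at_top"
    by (intro tendsto_intros lap_ratio s tail_tendsto_0)
  then have l1: "((\<lambda>t. lap (s / t)) \<longlongrightarrow> 1) at_top"
    by (simp add: less_imp_neq[OF tail_pos, symmetric])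
  have "((\<lambda>t. (1 - lap (s / t)) / tail t - lap (s / t) * ((z t - 1) / tail t)) \<longlongrightarrow> ?G - 1 * \<theta>) at_top"
    by (intro tendsto_intros lap_ratio s l1 zr)
  moreover have "(1 - lap (s / t)) / tail t - lap (s / t) * ((z t - 1) / tail t) = (1 - z t * lap (s / t)) / tail t" for t
    by (simp add: diff_divide_distrib[symmetric] algebra_simps)
  ultimately have den: "((\<lambda>t. (1 - z t * lap (s / t)) / tail t) \<longlongrightarrow> ?G - \<theta>) at_top" by simp
  have "\<forall>\<^sub>F t in at_top. (1 - z t * lap (s / t)) / tail t > 0"
    using \<theta> by (intro order_tendstoD(1)[OF den]) simp
  then show "\<forall>\<^sub>F t in at_top. z t * lap (s / t) < 1"
  proof eventually_elim
    case (elim t)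
    then show ?case using tail_pos[of t] by (simp add: zero_less_divide_iff)
  qed
  have "((\<lambda>t. z t * ((1 - lap (s / t)) / tail t) / ((1 - z t * lap (s / t)) / tail t)) \<longlongrightarrow> 1 * ?G / (?G - \<theta>)) at_top"
    using \<theta> by (intro tendsto_intros zlim den lap_ratio s) simp
  then show "((\<lambda>t. z t * (1 - lap (s / t)) / (1 - z t * lap (s / t))) \<longlongrightarrow> ?G / (?G - \<theta>)) at_top"
    by (simp add: less_imp_neq[OF tail_pos, symmetric])
qed

text \<open>\<open>laplace_mono_tendsto\<close> compares the transforms at the rates s (k + 1),
  where the condition on \<theta> persists because r powr \<alpha> does not decrease in r. For
  \<theta> \<ge> 0 the generating functions are nondecreasing in the level. For \<theta> < 0 they
  are nonincreasing and at most 1, so the argument is applied to 1 minus the function.\<close>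

lemma real_pgf_tendsto:
  fixes \<theta> :: real
  assumes s: "s > 0" and \<theta>: "\<theta> < Gamma (1 - \<alpha>) * s powr \<alpha>" and u: "u > 0"
    and h: "integrable (exp_law s) h" "isCont h u"
    and lap_h: "\<And>r. r \<ge> s \<Longrightarrow> integrable (exp_law r) h \<and> (\<integral>u. h u \<partial>exp_law r)
        = Gamma (1 - \<alpha>) * r powr \<alpha> / (Gamma (1 - \<alpha>) * r powr \<alpha> - \<theta>)"
  shows "((\<lambda>t. real_pgf (exp (\<theta> * tail t)) (t * u)) \<longlongrightarrow> h u) at_top"
proof -
  let ?f = "\<lambda>t u. real_pgf (exp (\<theta> * tail t)) (t * u)"
  have G: "Gamma (1 - \<alpha>) > 0" using alpha by simp
  have r: "s * real (Suc k) \<ge> s" for k using s by simp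
  have \<theta>r: "\<theta> < Gamma (1 - \<alpha>) * (s * real (Suc k)) powr \<alpha>" for k
  proof -
    have "Gamma (1 - \<alpha>) * s powr \<alpha> \<le> Gamma (1 - \<alpha>) * (s * real (Suc k)) powr \<alpha>"
      using G r alpha s by (intro mult_left_mono powr_mono2) auto
    with \<theta> show ?thesis by linarith
  qed
  have rpos: "s * real (Suc k) > 0" for k using s by simp
  have ev: "\<forall>\<^sub>F t in at_top. t > 0 \<and> exp (\<theta> * tail t) * lap (s * real (Suc k) / t) < 1" for k
    by (intro eventually_conj eventually_gt_at_top laplace_limit(1)[OF rpos \<theta>r])
  have evs: "\<forall>\<^sub>F t in at_top. t > 0 \<and> exp (\<theta> * tail t) * lap (s / t) < 1"
    using ev[of 0] by simp
  have int: "\<forall>\<^sub>F t in at_top. integrable (exp_law (s * real (Suc k))) (?f t) \<and>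
      (\<integral>u. ?f t u \<partial>exp_law (s * real (Suc k))) = exp (\<theta> * tail t) * (1 - lap (s * real (Suc k) / t)) /
        (1 - exp (\<theta> * tail t) * lap (s * real (Suc k) / t))" for k
    using ev[of k] by eventually_elim (intro conjI real_pgf_laplace rpos; simp)
  have conv: "((\<lambda>t. \<integral>u. ?f t u \<partial>exp_law (s * real (Suc k))) \<longlongrightarrow> (\<integral>u. h u \<partial>exp_law (s * real (Suc k)))) at_top" for k
    unfolding lap_h[OF r, THEN conjunct2]
    by (rule Lim_transform_eventually[OF laplace_limit(2)[OF rpos \<theta>r]])
      (use int[of k] in \<open>auto elim!: eventually_mono\<close>)
  show ?thesis
  proof (cases "\<theta> \<ge> 0")
    case True
    then have z: "exp (\<theta> * tail t) \<ge> 1" for t using tail_nonneg[of t] by simp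
    show ?thesis
    proof (rule laplace_mono_tendsto[where f = ?f, OF s u _ h conv])
      show "\<forall>\<^sub>F t in at_top. integrable (exp_law s) (?f t) \<and> (\<forall>u>0. 0 \<le> ?f t u) \<and>
          (\<forall>u v. 0 < u \<longrightarrow> u \<le> v \<longrightarrow> ?f t u \<le> ?f t v)"
        using evs
      proof eventually_elim
        case (elim t)
        then have st: "s / t > 0" using s by simp
        show ?case using elim
          by (auto intro!: real_pgf_laplace(1) s real_pgf_mono[OF z st])
      qed
    qed
  next
    case False
    then have z: "exp (\<theta> * tail t) \<le> 1" "exp (\<theta> * tail t) \<ge> 0" for t
      using tail_nonneg[of t] by (auto simp: mult_le_0_iff)
    have one: "(\<integral>u. 1 - p u \<partial>exp_law r) = 1 - (\<integral>u. p u \<partial>exp_law r)"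
      if "r > 0" "integrable (exp_law r) p" for r and p :: "real \<Rightarrow> real"
    proof -
      interpret R: prob_space "exp_law r" by (rule prob_space_exp_law[OF that(1)])
      show ?thesis using that(2) by (simp add: R.prob_space[unfolded space_exp_law])
    qed
    interpret E: prob_space "exp_law s" by (rule prob_space_exp_law[OF s])
    have "((\<lambda>t. 1 - ?f t u) \<longlongrightarrow> 1 - h u) at_top"
    proof (rule laplace_mono_tendsto[where f = "\<lambda>t u. 1 - ?f t u" and h = "\<lambda>u. 1 - h u", OF s u])
      show "\<forall>\<^sub>F t in at_top. integrable (exp_law s) (\<lambda>u. 1 - ?f t u) \<and> (\<forall>u>0. 0 \<le> 1 - ?f t u) \<and>
          (\<forall>u v. 0 < u \<longrightarrow> u \<le> v \<longrightarrow> 1 - ?f t u \<le> 1 - ?f t v)"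
        using evs
      proof eventually_elim
        case (elim t)
        then have "integrable (exp_law s) (?f t)" by (intro real_pgf_laplace s) auto
        then show ?case using elim z real_pgf_le_1[OF z(2,1)]
          by (auto intro!: real_pgf_antimono)
      qed
      show "((\<lambda>t. \<integral>u. 1 - ?f t u \<partial>exp_law (s * real (Suc k))) \<longlongrightarrow> (\<integral>u. 1 - h u \<partial>exp_law (s * real (Suc k)))) at_top" for k
        unfolding one[OF rpos lap_h[OF r, THEN conjunct1]]
        by (rule Lim_transform_eventually[OF tendsto_diff[OF tendsto_const conv]])
          (use int[of k] in \<open>auto elim!: eventually_mono simp: one[OF rpos] simp del: of_nat_Suc\<close>)
    qed (use h in \<open>auto intro: continuous_intros\<close>)
    from tendsto_diff[OF tendsto_const[of 1] this] show ?thesis by simp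
  qed
qed

end

section \<open>The Mittag-Leffler function and power moments\<close>

text \<open>Gamma (x + 1) is the moment of order x of a standard exponential variable, hence at
  least r powr x times the probability exp(-r) of exceeding r. As r is free, this beats every
  geometric growth in the Mittag-Leffler series.\<close>

lemma Gamma_ge_powr_exp:
  fixes x r :: real
  assumes "x \<ge> 0" "r > 0"
  shows "r powr x * exp (- r) \<le> Gamma (x + 1)"
proof -
  interpret E: prob_space "exp_law 1" by (rule prob_space_exp_law) simp
  have "emeasure (exp_law 1) {r..} = ennreal (exp (- r))"
  proof -
    have "E.prob {r..} = 1 - E.prob {0..<r}"
    proof -
      have "E.prob {r..} = E.prob (space (exp_law 1) - {0..<r})"
        using AE_exp_law_pos[of 1] assms(2)
        by (intro E.finite_measure_eq_AE) (auto elim!: eventually_mono)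
      then show ?thesis using E.prob_compl[of "{0..<r}"] by simp
    qed
    moreover have "E.prob {0..<r} = 1 - exp (- r)"
      using emeasure_exp_law_atLeastLessThan[of 1 0 r] assms(2) by (simp add: E.emeasure_eq_measure)
    ultimately show ?thesis by (simp add: E.emeasure_eq_measure)
  qed
  then have "ennreal (r powr x * exp (- r)) = (\<integral>\<^sup>+u. ennreal (r powr x) * indicator {r..} u \<partial>exp_law 1)"
    by (simp add: nn_integral_cmult_indicator ennreal_mult)
  also have "\<dots> \<le> (\<integral>\<^sup>+u. ennreal (u powr x) \<partial>exp_law 1)"
    using assms by (intro nn_integral_mono) (auto simp: indicator_def intro!: ennreal_leI powr_mono2)
  also have "\<dots> = ennreal (Gamma (x + 1))"
    using nn_integral_exp_law_powr[of 1 x] assms(1) by simp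
  finally show ?thesis using assms(1) by (simp add: Gamma_real_nonneg)
qed

lemma mittag_leffler_coeff_bound:
  fixes \<alpha> B :: real
  assumes "\<alpha> > 0" "B > 0"
  shows "\<exists>C. \<forall>k. B ^ k / Gamma (real k * \<alpha> + 1) \<le> C"
proof -
  \<comment> \<open>Chosen so that r powr (k * \<alpha>) = B ^ k; the bound on the coefficients is
    then exp r, uniformly in k.\<close>
  define r where "r = B powr (1 / \<alpha>)"
  have r: "r > 0" "r powr \<alpha> = B" using assms by (auto simp: r_def powr_powr)
  have "B ^ k / Gamma (real k * \<alpha> + 1) \<le> exp r" for k
  proof -
    have "r powr (real k * \<alpha>) = B ^ k"
      using r assms(2) by (simp add: powr_powr[symmetric] mult.commute[of "real k"] powr_realpow)
    moreover have "Gamma (real k * \<alpha> + 1) > 0" using assms(1) by (intro Gamma_real_pos) (simp add: add_nonneg_pos)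
    ultimately show ?thesis using Gamma_ge_powr_exp[of "real k * \<alpha>" r] assms(1) r(1)
      by (simp add: pos_divide_le_eq exp_minus field_simps)
  qed
  then show ?thesis by blast
qed

lemma summable_mittag_leffler:
  fixes \<alpha> z :: real
  assumes "\<alpha> > 0"
  shows "summable (\<lambda>k. norm (z ^ k / Gamma (real k * \<alpha> + 1)))"
proof -
  \<comment> \<open>The base 2 * \<bar>z\<bar> + 1 leaves the ratio \<bar>z\<bar> / (2 *
    \<bar>z\<bar> + 1), which is below 1 / 2; the summand 1 keeps the base positive for z =
    0.\<close>
  have pos: "0 < 2 * \<bar>z\<bar> + 1" by (simp add: add_nonneg_pos)
  obtain C where C: "\<And>k. (2 * \<bar>z\<bar> + 1) ^ k / Gamma (real k * \<alpha> + 1) \<le> C"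
    using mittag_leffler_coeff_bound[OF assms pos] by blast
  show ?thesis
  proof (rule summable_comparison_test')
    show "summable (\<lambda>k. C * (\<bar>z\<bar> / (2 * \<bar>z\<bar> + 1)) ^ k)"
      by (intro summable_mult summable_geometric) auto
    fix k :: nat
    have G: "Gamma (real k * \<alpha> + 1) > 0" using assms by (intro Gamma_real_pos) (simp add: add_nonneg_pos)
    have "\<bar>z\<bar> ^ k / Gamma (real k * \<alpha> + 1)
        = (2 * \<bar>z\<bar> + 1) ^ k / Gamma (real k * \<alpha> + 1) * (\<bar>z\<bar> / (2 * \<bar>z\<bar> + 1)) ^ k"
      by (simp add: power_divide)
    also have "\<dots> \<le> C * (\<bar>z\<bar> / (2 * \<bar>z\<bar> + 1)) ^ k"
      by (intro mult_right_mono C) auto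
    finally show "norm (norm (z ^ k / Gamma (real k * \<alpha> + 1))) \<le> C * (\<bar>z\<bar> / (2 * \<bar>z\<bar> + 1)) ^ k"
      using G by (simp add: power_abs abs_of_pos)
  qed
qed

lemma isCont_mittag_leffler:
  assumes "\<alpha> > 0"
  shows "isCont (mittag_leffler \<alpha>) z"
proof -
  have "isCont (\<lambda>z. \<Sum>k. (1 / Gamma (real k * \<alpha> + 1)) * z ^ k) z"
    using summable_norm_cancel[OF summable_mittag_leffler[OF assms, of "\<bar>z\<bar> + 1"]]
    by (intro isCont_powser[where K = "\<bar>z\<bar> + 1"]) auto
  then show ?thesis unfolding mittag_leffler_def[abs_def] by simp
qed

text \<open>At rate r the transform of u powr (k * \<alpha>) / Gamma (k * \<alpha> + 1) is the k-th
  power of 1 / r powr \<alpha>, so termwise integration yields a geometric series in c / r powr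
  \<alpha>. Exchanging sum and integral uses absolute convergence, hence the bound on the absolute
  value of c.\<close>

lemma mittag_leffler_laplace:
  assumes \<alpha>: "\<alpha> > 0" and r: "r > 0" and c: "\<bar>c\<bar> < r powr \<alpha>"
  shows "integrable (exp_law r) (\<lambda>u. mittag_leffler \<alpha> (c * u powr \<alpha>))"
    and "(\<integral>u. mittag_leffler \<alpha> (c * u powr \<alpha>) \<partial>exp_law r) = r powr \<alpha> / (r powr \<alpha> - c)"
proof -
  define f where "f k u = c ^ k * (u powr (real k * \<alpha>) / Gamma (real k * \<alpha> + 1))" for k u
  have G: "Gamma (real k * \<alpha> + 1) > 0" for k
    using \<alpha> by (intro Gamma_real_pos) (simp add: add_nonneg_pos)
  have rk: "r powr (real k * \<alpha>) = (r powr \<alpha>) ^ k" for k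
    using r by (simp add: powr_powr[symmetric] mult.commute[of "real k"] powr_realpow)
  have base: "integrable (exp_law r) (\<lambda>u. u powr (real k * \<alpha>))"
    "(\<integral>u. u powr (real k * \<alpha>) \<partial>exp_law r) = Gamma (real k * \<alpha> + 1) / (r powr \<alpha>) ^ k" for k
    using nn_integral_exp_law_powr[OF r, of "real k * \<alpha>"] \<alpha> less_imp_le[OF G[of k]]
    by (auto intro!: integrableI_nonneg simp: integral_eq_nn_integral rk less_le_trans[of "-1" 0])
  have fi: "integrable (exp_law r) (f k)" for k
    unfolding f_def using base(1)[of k] by simp
  have "(\<integral>u. f k u \<partial>exp_law r) = c ^ k * ((\<integral>u. u powr (real k * \<alpha>) \<partial>exp_law r) / Gamma (real k * \<alpha> + 1))" for k
    unfolding f_def by simp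
  then have fint: "(\<integral>u. f k u \<partial>exp_law r) = (c / r powr \<alpha>) ^ k" for k
    using less_imp_neq[OF G[of k]] by (simp add: base(2) power_divide)
  have "norm (f k u) = \<bar>c\<bar> ^ k * (u powr (real k * \<alpha>) / Gamma (real k * \<alpha> + 1))" for k u
    unfolding f_def using G[of k] by (simp add: abs_mult power_abs)
  then have "(\<integral>u. norm (f k u) \<partial>exp_law r) = \<bar>c\<bar> ^ k * ((\<integral>u. u powr (real k * \<alpha>) \<partial>exp_law r) / Gamma (real k * \<alpha> + 1))" for k
    by simp
  then have fnorm: "(\<integral>u. norm (f k u) \<partial>exp_law r) = (\<bar>c\<bar> / r powr \<alpha>) ^ k" for k
    using less_imp_neq[OF G[of k]] by (simp add: base(2) power_divide)
  \<comment> \<open>Restricted to u > 0: at u = 0 and k = 0 the sides differ, because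
    \<open>0 powr 0 = 0\<close> whereas \<open>0 ^ 0 = 1\<close>.\<close>
  have feq: "(c * u powr \<alpha>) ^ k / Gamma (real k * \<alpha> + 1) = f k u" if "u > 0" for k u
    using that by (simp add: f_def power_mult_distrib powr_powr[symmetric] mult.commute[of "real k"] powr_realpow)
  have summ: "AE u in exp_law r. summable (\<lambda>k. norm (f k u))"
    using AE_exp_law_pos[of r]
    by eventually_elim (use summable_mittag_leffler[OF \<alpha>] in \<open>simp add: feq[symmetric]\<close>)
  have sumn: "summable (\<lambda>k. \<integral>u. norm (f k u) \<partial>exp_law r)"
    unfolding fnorm using c r by (intro summable_geometric) simp
  have ae: "AE u in exp_law r. mittag_leffler \<alpha> (c * u powr \<alpha>) = (\<Sum>k. f k u)"
    using AE_exp_law_pos[of r] by eventually_elim (simp add: mittag_leffler_def feq)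
  have [measurable]: "mittag_leffler \<alpha> \<in> borel_measurable borel"
    using isCont_mittag_leffler[OF \<alpha>] by (intro borel_measurable_continuous_onI continuous_at_imp_continuous_on) auto
  have [measurable]: "f k \<in> borel_measurable borel" for k unfolding f_def by measurable
  have "integrable (exp_law r) (\<lambda>u. \<Sum>k. f k u)" by (intro integrable_suminf fi summ sumn)
  then show "integrable (exp_law r) (\<lambda>u. mittag_leffler \<alpha> (c * u powr \<alpha>))"
    by (rule integrable_cong_AE_imp) (use ae in \<open>auto elim: eventually_mono\<close>)
  have "(\<integral>u. mittag_leffler \<alpha> (c * u powr \<alpha>) \<partial>exp_law r) = (\<integral>u. (\<Sum>k. f k u) \<partial>exp_law r)"
    using ae by (intro integral_cong_AE) auto
  also have "\<dots> = (\<Sum>k. \<integral>u. f k u \<partial>exp_law r)" by (intro integral_suminf fi summ sumn)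
  also have "\<dots> = 1 / (1 - c / r powr \<alpha>)"
    unfolding fint using c r by (intro suminf_geometric) simp
  also have "\<dots> = r powr \<alpha> / (r powr \<alpha> - c)" using c r by (simp add: field_simps)
  finally show "(\<integral>u. mittag_leffler \<alpha> (c * u powr \<alpha>) \<partial>exp_law r) = r powr \<alpha> / (r powr \<alpha> - c)" .
qed

section \<open>From exponential moments to power moments\<close>

lemma exp_law_mgf:
  assumes "\<theta> < 1"
  shows "integrable (exp_law 1) (\<lambda>u. exp (\<theta> * u))" "(\<integral>u. exp (\<theta> * u) \<partial>exp_law 1) = 1 / (1 - \<theta>)"
proof -
  interpret E: prob_space "exp_law (1 - \<theta>)" by (rule prob_space_exp_law) (use assms in simp)
  have "(\<integral>\<^sup>+u. ennreal (exp (\<theta> * u)) \<partial>exp_law 1)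
      = (\<integral>\<^sup>+u. ennreal (1 / (1 - \<theta>)) * ennreal (exponential_density (1 - \<theta>) u) \<partial>lborel)"
    unfolding exp_law_def
    by (subst nn_integral_density, simp, simp, intro nn_integral_cong)
      (use assms in \<open>auto simp: exponential_density_def ennreal_mult[symmetric] exp_add[symmetric] field_simps\<close>)
  also have "\<dots> = ennreal (1 / (1 - \<theta>)) * emeasure (exp_law (1 - \<theta>)) (space (exp_law (1 - \<theta>)))"
    by (subst nn_integral_cmult) (auto simp: exp_law_def emeasure_density)
  finally have *: "(\<integral>\<^sup>+u. ennreal (exp (\<theta> * u)) \<partial>exp_law 1) = ennreal (1 / (1 - \<theta>))"
    by (simp only: E.emeasure_space_1 mult_1_right)
  show "integrable (exp_law 1) (\<lambda>u. exp (\<theta> * u))"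
    using * by (intro integrableI_nonneg) auto
  show "(\<integral>u. exp (\<theta> * u) \<partial>exp_law 1) = 1 / (1 - \<theta>)"
    using * assms by (subst integral_eq_nn_integral) auto
qed

text \<open>The inequality x \<le> exp x at x = c * y / p, raised to the power p.\<close>

lemma powr_le_exp:
  fixes y p c :: real
  assumes "y \<ge> 0" "p > 0" "c > 0"
  shows "y powr p \<le> (p / c) powr p * exp (c * y)"
proof -
  have "c * y / p \<le> exp (c * y / p)" using exp_ge_add_one_self[of "c * y / p"] by linarith
  then have "y \<le> p / c * exp (c * y / p)" using assms by (simp add: field_simps)
  then have "y powr p \<le> (p / c * exp (c * y / p)) powr p" using assms by (intro powr_mono2) auto
  also have "\<dots> = (p / c) powr p * exp (c * y)"
    using assms by (subst powr_mult) (auto simp: exp_powr_real)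
  finally show ?thesis .
qed

text \<open>With y = - c * ln x this is exp (- y / c) * y powr p, the test function behind the power
  moments. The delicate point is x = 0, where the value is 0: \<open>powr_le_exp\<close> with
  constant 1 / (2 * c) bounds the power by C / sqrt x, so the product is at most C * sqrt x.\<close>

lemma continuous_on_mult_ln_powr:
  fixes p c :: real
  assumes "p > 0" "c > 0"
  shows "continuous_on {0..1} (\<lambda>x. x * (- c * ln x) powr p)"
  unfolding continuous_on_eq_continuous_within
proof
  fix x :: real assume x: "x \<in> {0..1}"
  show "continuous (at x within {0..1}) (\<lambda>x. x * (- c * ln x) powr p)"
  proof (cases "x = 0")
    case False
    have "continuous_on {0<..1} (\<lambda>x. x * (- c * ln x) powr p)"
      using assms by (intro continuous_intros continuous_on_powr') (auto simp: mult_nonneg_nonpos)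
    then have "continuous (at x within {0<..1}) (\<lambda>x. x * (- c * ln x) powr p)"
      using x False by (simp add: continuous_on_eq_continuous_within)
    moreover have "at x within {0<..1} = at x within {0..1}"
      using x False by (intro at_within_nhd[of x "{0<..}"]) auto
    ultimately show ?thesis by (simp add: continuous_within)
  next
    case True
    define C where "C = (p / (1 / (2 * c))) powr p"
    have b: "\<bar>x * (- c * ln x) powr p\<bar> \<le> C * sqrt x" if "0 \<le> x" "x \<le> 1" for x
    proof (cases "x = 0")
      case False
      then have x: "x > 0" using that by simp
      have "(- c * ln x) powr p \<le> C * exp (1 / (2 * c) * (- c * ln x))"
        unfolding C_def using x that assms by (intro powr_le_exp) (auto simp: mult_nonneg_nonpos)
      also have "exp (1 / (2 * c) * (- c * ln x)) = 1 / sqrt x"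
        using x assms by (simp add: powr_half_sqrt[symmetric] powr_def exp_minus field_simps)
      finally have "x * (- c * ln x) powr p \<le> x * (C * (1 / sqrt x))"
        using x by (intro mult_left_mono) auto
      also have "\<dots> = C * (x / sqrt x)" by simp
      also have "\<dots> = C * sqrt x" using x by (simp only: real_div_sqrt less_imp_le)
      finally show ?thesis using x by (simp add: abs_mult)
    qed simp
    have "((\<lambda>x. x * (- c * ln x) powr p) \<longlongrightarrow> 0) (at 0 within {0..1})"
    proof (rule tendsto_rabs_zero_cancel, rule tendsto_sandwich[of "\<lambda>_. 0" _ _ "\<lambda>x. C * sqrt x"])
      have "((\<lambda>x. C * sqrt x) \<longlongrightarrow> C * sqrt 0) (at 0 within {0..1})" by (intro tendsto_intros)
      then show "((\<lambda>x. C * sqrt x) \<longlongrightarrow> 0) (at 0 within {0..1})" by simp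
    qed (use b in \<open>auto simp: eventually_at_filter\<close>)
    then show ?thesis using True by (simp add: continuous_within)
  qed
qed

text \<open>The k-th moment of exp(-Y/2) under the weight exp(Y/2) is the exponential moment of Y at
  (1 - k) / 2. These parameters are all below 1, so the hypotheses are also met by the standard
  exponential law, whose exponential moments are infinite from 1 on.\<close>

lemma powr_moments_tendsto:
  fixes Y :: "'i \<Rightarrow> 'a \<Rightarrow> real" and W :: "'b \<Rightarrow> real"
  assumes p: "p > 0"
    and Y: "\<And>i. Y i \<in> borel_measurable (M i)" "\<And>i. AE a in M i. 0 \<le> Y i a"
    and W: "W \<in> borel_measurable N" "AE b in N. 0 \<le> W b"
    and intY: "\<And>\<theta>. \<theta> < 1 \<Longrightarrow> \<forall>\<^sub>F i in F. integrable (M i) (\<lambda>a. exp (\<theta> * Y i a))"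
    and intW: "\<And>\<theta>. \<theta> < 1 \<Longrightarrow> integrable N (\<lambda>b. exp (\<theta> * W b))"
    and lim: "\<And>\<theta>. \<theta> < 1 \<Longrightarrow> ((\<lambda>i. \<integral>a. exp (\<theta> * Y i a) \<partial>M i) \<longlongrightarrow> (\<integral>b. exp (\<theta> * W b) \<partial>N)) F"
  shows "((\<lambda>i. \<integral>\<^sup>+a. ennreal (Y i a powr p) \<partial>M i) \<longlongrightarrow> (\<integral>\<^sup>+b. ennreal (W b powr p) \<partial>N)) F"
proof -
  note [measurable] = Y(1) W(1)
  let ?g = "\<lambda>x::real. x * (- 2 * ln x) powr p"
  have id: "exp (1 / 2 * y) * ?g (exp (- (1 / 2) * y)) = y powr p" for y :: real
    by (simp add: exp_add[symmetric] mult.assoc[symmetric])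
  have ex: "exp (1 / 2 * y) * exp (- (1 / 2) * y) ^ k = exp ((1 - real k) / 2 * y)" for y :: real and k
    by (simp add: exp_of_nat_mult[symmetric] exp_add[symmetric] field_simps)
  have lim_real: "((\<lambda>i. \<integral>a. Y i a powr p \<partial>M i) \<longlongrightarrow> (\<integral>b. W b powr p \<partial>N)) F"
  proof -
    have "((\<lambda>i. \<integral>a. exp (1 / 2 * Y i a) * ?g (exp (- (1 / 2) * Y i a)) \<partial>M i) \<longlongrightarrow>
        (\<integral>b. exp (1 / 2 * W b) * ?g (exp (- (1 / 2) * W b)) \<partial>N)) F"
    proof (rule weighted_moments_tendsto[where w = "\<lambda>i a. exp (1 / 2 * Y i a)"
          and x = "\<lambda>i a. exp (- (1 / 2) * Y i a)" and v = "\<lambda>b. exp (1 / 2 * W b)" and y = "\<lambda>b. exp (- (1 / 2) * W b)" and g = ?g])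
      show "\<forall>\<^sub>F i in F. integrable (M i) (\<lambda>a. exp (1 / 2 * Y i a)) \<and>
          (\<lambda>a. exp (- (1 / 2) * Y i a)) \<in> borel_measurable (M i) \<and>
          (AE a in M i. 0 \<le> exp (1 / 2 * Y i a) \<and> 0 \<le> exp (- (1 / 2) * Y i a) \<and> exp (- (1 / 2) * Y i a) \<le> 1)"
        using intY[of "1 / 2", simplified]
      proof eventually_elim
        case (elim i)
        then show ?case using Y(2)[of i] by (auto elim!: eventually_mono)
      qed
      show "((\<lambda>i. \<integral>a. exp (1 / 2 * Y i a) * exp (- (1 / 2) * Y i a) ^ k \<partial>M i) \<longlongrightarrow>
          (\<integral>b. exp (1 / 2 * W b) * exp (- (1 / 2) * W b) ^ k \<partial>N)) F" for k
        unfolding ex by (rule lim) simp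
      show "continuous_on {0..1} ?g"
        using continuous_on_mult_ln_powr[OF p, of 2] by simp
    qed (use intW[of "1 / 2"] W(2) in \<open>auto elim!: eventually_mono\<close>)
    then show ?thesis unfolding id .
  qed
  have nn: "(\<integral>\<^sup>+a. ennreal (Z a powr p) \<partial>K) = ennreal (\<integral>a. Z a powr p \<partial>K)"
    if "integrable K (\<lambda>a. exp (1 / 2 * Z a))" "Z \<in> borel_measurable K" "AE a in K. 0 \<le> Z a" for K :: "'c measure" and Z
  proof (rule nn_integral_eq_integral)
    note [measurable] = that(2)
    show "integrable K (\<lambda>a. Z a powr p)"
    proof (rule Bochner_Integration.integrable_bound)
      show "integrable K (\<lambda>a. (p / (1 / 2)) powr p * exp (1 / 2 * Z a))" using that(1) by simp
      show "AE a in K. norm (Z a powr p) \<le> norm ((p / (1 / 2)) powr p * exp (1 / 2 * Z a))"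
        using that(3)
      proof eventually_elim
        case (elim a)
        show ?case using powr_le_exp[OF elim p, of "1 / 2"] by simp
      qed
    qed measurable
  qed simp
  note nnW = nn[OF intW[of "1 / 2"] W, simplified]
  show "((\<lambda>i. \<integral>\<^sup>+a. ennreal (Y i a powr p) \<partial>M i) \<longlongrightarrow> (\<integral>\<^sup>+b. ennreal (W b powr p) \<partial>N)) F"
    unfolding nnW
  proof (rule Lim_transform_eventually[OF tendsto_ennrealI[OF lim_real]])
    have "\<forall>\<^sub>F i in F. integrable (M i) (\<lambda>a. exp (1 / 2 * Y i a))" by (rule intY) simp
    then show "\<forall>\<^sub>F i in F. ennreal (\<integral>a. Y i a powr p \<partial>M i) = (\<integral>\<^sup>+a. ennreal (Y i a powr p) \<partial>M i)"
      by eventually_elim (rule nn[OF _ Y, symmetric])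
  qed
qed

text \<open>By Markov's inequality W \<le> - e has probability at most exp(-n e) for every n, hence
  0. For \<alpha> > 0 the predicate \<open>mittag_leffler_distributed\<close> prescribes only
  measurability and the moment generating function, so nonnegativity has to be derived.\<close>

lemma (in prob_space) AE_nonneg_of_laplace_le_1:
  assumes [measurable]: "W \<in> borel_measurable M"
    and int: "\<And>n::nat. integrable M (\<lambda>\<omega>. exp (- real n * W \<omega>))"
    and le: "\<And>n::nat. expectation (\<lambda>\<omega>. exp (- real n * W \<omega>)) \<le> 1"
  shows "AE \<omega> in M. 0 \<le> W \<omega>"
proof -
  have "AE \<omega> in M. - (1 / real (Suc m)) < W \<omega>" for m
  proof (rule AE_I[where N = "{\<omega> \<in> space M. W \<omega> \<le> - (1 / real (Suc m))}"])
    define e where "e = 1 / real (Suc m)"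
    have e: "e > 0" by (simp add: e_def)
    have "prob {\<omega> \<in> space M. W \<omega> \<le> - e} \<le> exp (- e) ^ n" for n :: nat
    proof -
      have "prob {\<omega> \<in> space M. W \<omega> \<le> - e} \<le> prob {\<omega> \<in> space M. exp (real n * e) \<le> exp (- real n * W \<omega>)}"
      proof (rule finite_measure_mono)
        have "exp (real n * e) \<le> exp (- real n * W \<omega>)" if "W \<omega> \<le> - e" for \<omega>
          using mult_left_mono[OF that, of "real n"] by simp
        then show "{\<omega> \<in> space M. W \<omega> \<le> - e} \<subseteq> {\<omega> \<in> space M. exp (real n * e) \<le> exp (- real n * W \<omega>)}"
          by blast
      qed measurable
      also have "\<dots> \<le> expectation (\<lambda>\<omega>. exp (- real n * W \<omega>)) / exp (real n * e)"
        using int by (intro integral_Markov_inequality_measure[where A = "{}"]) auto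
      also have "\<dots> \<le> 1 / exp (real n * e)" by (intro divide_right_mono le) simp
      also have "\<dots> = exp (- e) ^ n" by (simp add: exp_of_nat_mult[symmetric] exp_minus field_simps)
      finally show ?thesis .
    qed
    moreover have "(\<lambda>n. exp (- e) ^ n) \<longlonglongrightarrow> 0" using e by (intro LIMSEQ_power_zero) simp
    ultimately have "prob {\<omega> \<in> space M. W \<omega> \<le> - e} \<le> 0"
      by (intro LIMSEQ_le_const[where X = "\<lambda>n. exp (- e) ^ n"]) auto
    then show "emeasure M {\<omega> \<in> space M. W \<omega> \<le> - (1 / real (Suc m))} = 0"
      by (simp add: emeasure_eq_measure measure_le_0_iff e_def)
  qed (auto simp: not_less)
  then have "AE \<omega> in M. \<forall>m. - (1 / real (Suc m)) < W \<omega>" by (simp only: AE_all_countable) simp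
  then show ?thesis
  proof eventually_elim
    case (elim \<omega>)
    show ?case
    proof (rule ccontr)
      assume "\<not> 0 \<le> W \<omega>"
      then obtain m where "1 / real (Suc m) < - W \<omega>" using nat_approx_posE[of "- W \<omega>"] by auto
      then show False using elim[rule_format, of m] by simp
    qed
  qed
qed

section \<open>The first passage time\<close>

context positive_iid_walk
begin

lemma first_passage_measurable [measurable]: "N t \<in> measurable M (count_space UNIV)"
proof -
  have "N t = (\<lambda>\<omega>. LEAST k. k \<ge> 1 \<and> S k \<omega> > t)"
    by (simp add: first_passage_def Inf_nat_def fun_eq_iff)
  moreover have "(\<lambda>\<omega>. LEAST k. k \<ge> 1 \<and> S k \<omega> > t) \<in> measurable M (count_space UNIV)"
    by measurable
  ultimately show ?thesis by simp
qed

definition scaled_passage :: "real \<Rightarrow> 'a \<Rightarrow> real" where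
  "scaled_passage t \<omega> = tail t * real (N t \<omega>)"

lemma scaled_passage_measurable [measurable]: "scaled_passage t \<in> borel_measurable M"
  unfolding scaled_passage_def[abs_def] by measurable

lemma scaled_passage_nonneg [simp]: "0 \<le> scaled_passage t \<omega>"
  by (simp add: scaled_passage_def tail_nonneg)

lemma nn_integral_exp_scaled_passage: "(\<integral>\<^sup>+\<omega>. ennreal (exp (\<theta> * scaled_passage t \<omega>)) \<partial>M) = pgf (exp (\<theta> * tail t)) t"
  unfolding pgf_def scaled_passage_def by (simp add: exp_of_nat_mult[symmetric] mult_ac)

text \<open>For the case p = 0: since \<open>0 powr 0 = 0\<close>, the zeroth power moment is 1 only
  if the variable is almost surely nonzero.\<close>

lemma AE_scaled_passage_pos: "tail t > 0 \<Longrightarrow> AE \<omega> in M. scaled_passage t \<omega> > 0"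
  using AE_good
proof eventually_elim
  case (elim \<omega>)
  then have "N t \<omega> \<ge> 1" by (intro first_passage_props(1)) auto
  then show ?case using elim by (simp add: scaled_passage_def)
qed

end

section \<open>Convergence of moments and the moments of the limit law\<close>

context regularly_varying_walk
begin

abbreviation "G \<equiv> Gamma (1 - \<alpha>)"

lemma G_pos: "G > 0"
  using alpha by simp

text \<open>For \<alpha> > 0 the power s powr \<alpha> can be made as large as desired. For \<alpha>
  = 0 it is always 1 and G = 1, so the requirement is \<theta> < 1 itself.\<close>

lemma admissible_scale:
  assumes "\<alpha> > 0 \<or> \<theta> < 1"
  obtains s where "s > 0" "\<theta> < G * s powr \<alpha>"
proof (cases "\<alpha> > 0")
  case True
  define s where "s = (\<bar>\<theta>\<bar> / G + 1) powr (1 / \<alpha>)"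
  have "\<bar>\<theta>\<bar> / G + 1 > 0" using G_pos by (intro add_nonneg_pos) auto
  then have "s > 0" "s powr \<alpha> = \<bar>\<theta>\<bar> / G + 1" using True by (auto simp: s_def powr_powr)
  moreover have "\<theta> < G * (\<bar>\<theta>\<bar> / G + 1)" using G_pos by (simp add: distrib_left)
  ultimately show ?thesis using that[of s] by simp
next
  case False
  then have "\<alpha> = 0" using alpha by simp
  then show ?thesis using that[of 1] assms by simp
qed

lemma eventually_exp_scaled_passage:
  assumes "\<alpha> > 0 \<or> \<theta> < 1"
  shows "\<forall>\<^sub>F t in at_top. integrable M (\<lambda>\<omega>. exp (\<theta> * scaled_passage t \<omega>)) \<and>
      expectation (\<lambda>\<omega>. exp (\<theta> * scaled_passage t \<omega>)) = real_pgf (exp (\<theta> * tail t)) t \<and>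
      pgf (exp (\<theta> * tail t)) t = ennreal (real_pgf (exp (\<theta> * tail t)) t)"
proof -
  obtain s where s: "s > 0" "\<theta> < G * s powr \<alpha>" using admissible_scale[OF assms] .
  show ?thesis
    using laplace_limit(1)[OF s] eventually_gt_at_top[of 0]
  proof eventually_elim
    case (elim t)
    then have g: "pgf (exp (\<theta> * tail t)) t = ennreal (real_pgf (exp (\<theta> * tail t)) t)"
      using s by (intro pgf_eq_real_pgf[of _ "s / t"]) auto
    have nn: "(\<integral>\<^sup>+\<omega>. ennreal (exp (\<theta> * scaled_passage t \<omega>)) \<partial>M) = ennreal (real_pgf (exp (\<theta> * tail t)) t)"
      by (simp only: nn_integral_exp_scaled_passage g)
    then have "integrable M (\<lambda>\<omega>. exp (\<theta> * scaled_passage t \<omega>))" by (intro integrableI_nonneg) auto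
    moreover have "expectation (\<lambda>\<omega>. exp (\<theta> * scaled_passage t \<omega>)) = real_pgf (exp (\<theta> * tail t)) t"
      by (subst integral_eq_nn_integral) (auto simp: nn)
    ultimately show ?case using g by simp
  qed
qed

lemma real_pgf_tendsto_mittag_leffler:
  assumes \<alpha>: "\<alpha> > 0" and u: "u > 0"
  shows "((\<lambda>t. real_pgf (exp (\<theta> * tail t)) (t * u)) \<longlongrightarrow> mittag_leffler \<alpha> (\<theta> / G * u powr \<alpha>)) at_top"
proof -
  \<comment> \<open>The scale is chosen for the absolute value of \<theta>, since
    \<open>mittag_leffler_laplace\<close> bounds the absolute value of its coefficient.\<close>
  obtain s where s: "s > 0" "\<bar>\<theta>\<bar> < G * s powr \<alpha>" using admissible_scale[of "\<bar>\<theta>\<bar>"] \<alpha> by blast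
  have c: "\<bar>\<theta> / G\<bar> < r powr \<alpha>" if "r \<ge> s" for r
  proof -
    have "\<bar>\<theta> / G\<bar> < s powr \<alpha>" using s(2) G_pos by (simp add: abs_divide pos_divide_less_eq mult.commute)
    also have "\<dots> \<le> r powr \<alpha>" using that s(1) \<alpha> by (intro powr_mono2) auto
    finally show ?thesis .
  qed
  show ?thesis
  proof (rule real_pgf_tendsto[OF s(1) _ u])
    show "integrable (exp_law s) (\<lambda>u. mittag_leffler \<alpha> (\<theta> / G * u powr \<alpha>))"
      using mittag_leffler_laplace(1)[OF \<alpha> s(1) c] by simp
    show "isCont (\<lambda>u. mittag_leffler \<alpha> (\<theta> / G * u powr \<alpha>)) u"
      using u by (intro isCont_o2[OF _ isCont_mittag_leffler[OF \<alpha>]] continuous_intros) auto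
    fix r assume r: "r \<ge> s"
    then have "r > 0" using s(1) by simp
    moreover have "r powr \<alpha> / (r powr \<alpha> - \<theta> / G) = G * r powr \<alpha> / (G * r powr \<alpha> - \<theta>)"
      using G_pos by (simp add: field_simps)
    ultimately show "integrable (exp_law r) (\<lambda>u. mittag_leffler \<alpha> (\<theta> / G * u powr \<alpha>)) \<and>
        (\<integral>u. mittag_leffler \<alpha> (\<theta> / G * u powr \<alpha>) \<partial>exp_law r) = G * r powr \<alpha> / (G * r powr \<alpha> - \<theta>)"
      using mittag_leffler_laplace[OF \<alpha> _ c[OF r]] by simp
  qed (use s(2) in auto)
qed

text \<open>For \<alpha> = 0 the limiting transform G * r powr \<alpha> / (G * r powr \<alpha> -
  \<theta>) equals 1 / (1 - \<theta>) at every rate, so the limit function is constant in u.\<close>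

lemma real_pgf_tendsto_exponential:
  assumes \<alpha>: "\<alpha> = 0" and \<theta>: "\<theta> < 1" and u: "u > 0"
  shows "((\<lambda>t. real_pgf (exp (\<theta> * tail t)) (t * u)) \<longlongrightarrow> 1 / (1 - \<theta>)) at_top"
proof (rule real_pgf_tendsto[of 1 _ _ "\<lambda>_. 1 / (1 - \<theta>)"])
  have E: "finite_measure (exp_law r)" "measure (exp_law r) UNIV = 1" if "r > 0" for r
  proof -
    interpret E: prob_space "exp_law r" by (rule prob_space_exp_law[OF that])
    show "finite_measure (exp_law r)" "measure (exp_law r) UNIV = 1"
      using E.finite_measure_axioms E.prob_space by auto
  qed
  then show "integrable (exp_law 1) (\<lambda>_. 1 / (1 - \<theta>))"
    by (simp add: finite_measure.integrable_const)
  show "integrable (exp_law r) (\<lambda>_. 1 / (1 - \<theta>)) \<and>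
      (\<integral>u. 1 / (1 - \<theta>) \<partial>exp_law r) = G * r powr \<alpha> / (G * r powr \<alpha> - \<theta>)" if "r \<ge> 1" for r
    using E[of r] that \<alpha> by (simp add: finite_measure.integrable_const)
qed (use \<alpha> \<theta> u in auto)

text \<open>For 0 \<le> \<theta> < 1 this is the termwise computation. For negative \<theta> the
  function is the pointwise limit of the generating functions at parameter \<theta> * G, which are
  bounded by 1; dominated convergence identifies its transform with the limit from
  \<open>laplace_limit\<close>. The walk enters only as the source of these approximations.\<close>

lemma mittag_leffler_laplace_1:
  assumes \<alpha>: "\<alpha> > 0" and \<theta>: "\<theta> < 1"
  shows "integrable (exp_law 1) (\<lambda>u. mittag_leffler \<alpha> (\<theta> * u powr \<alpha>))"
    and "(\<integral>u. mittag_leffler \<alpha> (\<theta> * u powr \<alpha>) \<partial>exp_law 1) = 1 / (1 - \<theta>)"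
proof -
  have "integrable (exp_law 1) (\<lambda>u. mittag_leffler \<alpha> (\<theta> * u powr \<alpha>)) \<and>
    (\<integral>u. mittag_leffler \<alpha> (\<theta> * u powr \<alpha>) \<partial>exp_law 1) = 1 / (1 - \<theta>)"
  proof (cases "\<theta> \<ge> 0")
    case True
    then show ?thesis using mittag_leffler_laplace[OF \<alpha>, of 1 \<theta>] \<theta> by simp
  next
    case False
    interpret E: prob_space "exp_law 1" by (rule prob_space_exp_law) simp
    let ?f = "\<lambda>t u. real_pgf (exp (\<theta> * G * tail t)) (t * u)"
    have neg: "\<theta> * G < 0" using False G_pos by (simp add: mult_less_0_iff)
    have G1: "\<theta> * G < G * 1 powr \<alpha>" by (rule less_trans[OF neg]) (use G_pos in simp)
    have z: "exp (\<theta> * G * tail t) \<le> 1" for t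
      using mult_nonpos_nonneg[OF less_imp_le[OF neg] tail_nonneg[of t]] by simp
    \<comment> \<open>As the parameter is negative, rate 1 meets the condition for every t, so
      measurability holds for all t rather than eventually.\<close>
    have zl: "exp (\<theta> * G * tail t) * lap 1 < 1" for t
      by (rule le_less_trans[OF mult_right_mono[OF z[of t], of "lap 1"]]) (use lap_bounds[of 1] in simp_all)
    have [measurable]: "real_pgf (exp (\<theta> * G * tail t)) \<in> borel_measurable borel" for t
      by (rule real_pgf_measurable[of _ 1]) (use zl in auto)
    have [measurable]: "mittag_leffler \<alpha> \<in> borel_measurable borel"
      using isCont_mittag_leffler[OF \<alpha>] by (intro borel_measurable_continuous_onI continuous_at_imp_continuous_on) auto
    have lim: "((\<lambda>t. ?f t u) \<longlongrightarrow> mittag_leffler \<alpha> (\<theta> * u powr \<alpha>)) at_top" if "u > 0" for u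
      using real_pgf_tendsto_mittag_leffler[OF \<alpha> that, of "\<theta> * G"] G_pos by simp
    have conv: "((\<lambda>t. \<integral>u. ?f t u \<partial>exp_law 1) \<longlongrightarrow> (\<integral>u. mittag_leffler \<alpha> (\<theta> * u powr \<alpha>) \<partial>exp_law 1)) at_top"
    proof (rule integral_dominated_convergence_at_top[where w = "\<lambda>_. 1"])
      show "AE u in exp_law 1. ((\<lambda>t. ?f t u) \<longlongrightarrow> mittag_leffler \<alpha> (\<theta> * u powr \<alpha>)) at_top"
        using AE_exp_law_pos[of 1] by eventually_elim (rule lim)
    qed (use real_pgf_le_1[OF _ z] in auto)
    have "((\<lambda>t. \<integral>u. ?f t u \<partial>exp_law 1) \<longlongrightarrow> G * 1 powr \<alpha> / (G * 1 powr \<alpha> - \<theta> * G)) at_top"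
    proof (rule Lim_transform_eventually[OF laplace_limit(2)])
      show "\<forall>\<^sub>F t in at_top. exp (\<theta> * G * tail t) * (1 - lap (1 / t)) / (1 - exp (\<theta> * G * tail t) * lap (1 / t))
          = (\<integral>u. ?f t u \<partial>exp_law 1)"
        using laplace_limit(1)[OF zero_less_one G1] eventually_gt_at_top[of 0]
        by eventually_elim (simp add: real_pgf_laplace(2))
      show "\<theta> * G < G * 1 powr \<alpha>" by (rule G1)
    qed simp
    moreover have "G * 1 powr \<alpha> / (G * 1 powr \<alpha> - \<theta> * G) = 1 / (1 - \<theta>)"
    proof -
      have "G * 1 powr \<alpha> - \<theta> * G = G * (1 - \<theta>)" by (simp add: algebra_simps)
      then show ?thesis using G_pos by simp
    qed
    ultimately have "(\<integral>u. mittag_leffler \<alpha> (\<theta> * u powr \<alpha>) \<partial>exp_law 1) = 1 / (1 - \<theta>)"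
      using tendsto_unique[OF _ conv] by simp
    moreover have "integrable (exp_law 1) (\<lambda>u. mittag_leffler \<alpha> (\<theta> * u powr \<alpha>))"
    proof (rule E.integrable_const_bound[where B = 1])
      show "AE u in exp_law 1. norm (mittag_leffler \<alpha> (\<theta> * u powr \<alpha>)) \<le> 1"
        using AE_exp_law_pos[of 1]
      proof eventually_elim
        case (elim u)
        show ?case
          by (rule tendsto_upperbound[OF tendsto_norm[OF lim[OF elim]]]) (use real_pgf_le_1[OF _ z] in auto)
      qed
    qed measurable
    ultimately show ?thesis by simp
  qed
  then show "integrable (exp_law 1) (\<lambda>u. mittag_leffler \<alpha> (\<theta> * u powr \<alpha>))"
    "(\<integral>u. mittag_leffler \<alpha> (\<theta> * u powr \<alpha>) \<partial>exp_law 1) = 1 / (1 - \<theta>)" by auto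
qed

text \<open>At the parameters -n the base z is at most 1, hence so are the generating functions and
  their limits, as \<open>AE_nonneg_of_laplace_le_1\<close> asks.\<close>

lemma limit_nonneg:
  fixes W :: "'b \<Rightarrow> real"
  assumes "prob_space R" "W \<in> borel_measurable R"
    and int: "\<And>\<theta>. \<theta> < 1 \<Longrightarrow> integrable R (\<lambda>\<omega>. exp (\<theta> * W \<omega>))"
    and lim: "\<And>\<theta>. \<theta> < 1 \<Longrightarrow> ((\<lambda>t. real_pgf (exp (\<theta> * tail t)) t) \<longlongrightarrow> (\<integral>\<omega>. exp (\<theta> * W \<omega>) \<partial>R)) at_top"
  shows "AE \<omega> in R. 0 \<le> W \<omega>"
proof -
  interpret R: prob_space R by fact
  show ?thesis
  proof (rule R.AE_nonneg_of_laplace_le_1)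
    fix n :: nat
    show "integrable R (\<lambda>\<omega>. exp (- real n * W \<omega>))" by (rule int) simp
    have "exp (- real n * tail t) \<le> 1" for t by (simp add: mult_nonneg_nonneg tail_nonneg)
    then show "R.expectation (\<lambda>\<omega>. exp (- real n * W \<omega>)) \<le> 1"
      by (intro tendsto_upperbound[OF lim]) (auto intro!: always_eventually real_pgf_le_1)
  qed (use assms in auto)
qed

lemma moments_tendsto:
  fixes W :: "'b \<Rightarrow> real"
  assumes R: "prob_space R" "W \<in> borel_measurable R"
    and int: "\<And>\<theta>. \<theta> < 1 \<Longrightarrow> integrable R (\<lambda>\<omega>. exp (\<theta> * W \<omega>))"
    and lim: "\<And>\<theta>. \<theta> < 1 \<Longrightarrow> ((\<lambda>t. real_pgf (exp (\<theta> * tail t)) t) \<longlongrightarrow> (\<integral>\<omega>. exp (\<theta> * W \<omega>) \<partial>R)) at_top"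
    and p: "p > 0"
  shows "((\<lambda>t. \<integral>\<^sup>+\<omega>. ennreal (scaled_passage t \<omega> powr p) \<partial>M) \<longlongrightarrow> (\<integral>\<^sup>+\<omega>. ennreal (W \<omega> powr p) \<partial>R)) at_top"
proof (rule powr_moments_tendsto[OF p, where M = "\<lambda>_. M"])
  show "AE \<omega> in R. 0 \<le> W \<omega>" by (rule limit_nonneg[OF R int lim])
  fix \<theta> :: real assume \<theta>: "\<theta> < 1"
  then have ev: "\<forall>\<^sub>F t in at_top. integrable M (\<lambda>\<omega>. exp (\<theta> * scaled_passage t \<omega>)) \<and>
      real_pgf (exp (\<theta> * tail t)) t = expectation (\<lambda>\<omega>. exp (\<theta> * scaled_passage t \<omega>))"
    using eventually_exp_scaled_passage[of \<theta>] by (auto elim!: eventually_mono)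
  show "\<forall>\<^sub>F t in at_top. integrable M (\<lambda>\<omega>. exp (\<theta> * scaled_passage t \<omega>))"
    using ev by (auto elim!: eventually_mono)
  show "((\<lambda>t. expectation (\<lambda>\<omega>. exp (\<theta> * scaled_passage t \<omega>))) \<longlongrightarrow> (\<integral>\<omega>. exp (\<theta> * W \<omega>) \<partial>R)) at_top"
    by (rule Lim_transform_eventually[OF lim[OF \<theta>]]) (use ev in \<open>auto elim!: eventually_mono\<close>)
qed (use R int in auto)

lemma mittag_leffler_moments:
  fixes W :: "'b \<Rightarrow> real"
  assumes \<alpha>: "\<alpha> > 0" and R: "prob_space R" and W [measurable]: "W \<in> borel_measurable R"
    and int: "\<And>\<theta>. integrable R (\<lambda>\<omega>. exp (\<theta> * W \<omega>))"
    and mgf: "\<And>\<theta>. (\<integral>\<omega>. exp (\<theta> * W \<omega>) \<partial>R) = mittag_leffler \<alpha> (\<theta> / G)"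
    and Wpos: "AE \<omega> in R. 0 \<le> W \<omega>" and p: "p \<ge> 0"
  shows "(\<integral>\<^sup>+\<omega>. ennreal (W \<omega> powr p) \<partial>R) = ennreal (Gamma (p + 1) / (G powr p * Gamma (p * \<alpha> + 1)))"
proof -
  interpret R: prob_space R by fact
  interpret E: prob_space "exp_law 1" by (rule prob_space_exp_law) simp
  interpret ER: pair_prob_space "exp_law 1" R ..
  \<comment> \<open>The truncation changes G * W on a null set only and makes \<open>Z\<close>
    nonnegative everywhere on the product space.\<close>
  define V where "V \<omega> = max 0 (G * W \<omega>)" for \<omega>
  have V0: "0 \<le> V \<omega>" for \<omega> by (simp add: V_def)
  have [measurable]: "V \<in> borel_measurable R" unfolding V_def[abs_def] by measurable
  have VW: "AE \<omega> in R. V \<omega> = G * W \<omega>"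
    using Wpos G_pos by (auto elim!: eventually_mono simp: V_def)
  define Z where "Z = (\<lambda>(u, \<omega>). u powr \<alpha> * V \<omega>)"
  have Z0: "0 \<le> Z x" for x by (auto simp: Z_def V0 split: prod.split)
  have [measurable]: "Z \<in> borel_measurable (exp_law 1 \<Otimes>\<^sub>M R)" unfolding Z_def by measurable
  have mgfZ: "(\<integral>\<^sup>+x. ennreal (exp (\<theta> * Z x)) \<partial>(exp_law 1 \<Otimes>\<^sub>M R)) = ennreal (1 / (1 - \<theta>))"
    if \<theta>: "\<theta> < 1" for \<theta>
  proof -
    have inner: "(\<integral>\<^sup>+\<omega>. ennreal (exp (\<theta> * Z (u, \<omega>))) \<partial>R) = ennreal (mittag_leffler \<alpha> (\<theta> * u powr \<alpha>))" for u
    proof -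
      have "(\<integral>\<^sup>+\<omega>. ennreal (exp (\<theta> * Z (u, \<omega>))) \<partial>R) = (\<integral>\<^sup>+\<omega>. ennreal (exp (\<theta> * u powr \<alpha> * G * W \<omega>)) \<partial>R)"
        using VW by (intro nn_integral_cong_AE) (auto elim!: eventually_mono simp: Z_def mult_ac)
      also have "\<dots> = ennreal (\<integral>\<omega>. exp (\<theta> * u powr \<alpha> * G * W \<omega>) \<partial>R)"
        by (intro nn_integral_eq_integral int) simp
      finally show ?thesis using G_pos unfolding mgf by simp
    qed
    have nonneg: "0 \<le> mittag_leffler \<alpha> (\<theta> * u powr \<alpha>)" for u
      using mgf[of "\<theta> * u powr \<alpha> * G"] G_pos Bochner_Integration.integral_nonneg[of R "\<lambda>\<omega>. exp (\<theta> * u powr \<alpha> * G * W \<omega>)"]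
      by simp
    have "(\<integral>\<^sup>+x. ennreal (exp (\<theta> * Z x)) \<partial>(exp_law 1 \<Otimes>\<^sub>M R))
        = (\<integral>\<^sup>+u. \<integral>\<^sup>+\<omega>. ennreal (exp (\<theta> * Z (u, \<omega>))) \<partial>R \<partial>exp_law 1)"
      by (rule R.nn_integral_fst[symmetric]) measurable
    also have "\<dots> = ennreal (\<integral>u. mittag_leffler \<alpha> (\<theta> * u powr \<alpha>) \<partial>exp_law 1)"
      unfolding inner by (intro nn_integral_eq_integral mittag_leffler_laplace_1 \<alpha> \<theta>) (simp add: nonneg)
    also have "\<dots> = ennreal (1 / (1 - \<theta>))" by (simp add: mittag_leffler_laplace_1 \<alpha> \<theta>)
    finally show ?thesis .
  qed
  show ?thesis
  proof (cases "p = 0")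
    case True
    \<comment> \<open>Since \<open>0 powr 0 = 0\<close>, the zeroth moment is the probability that W
      is nonzero, so an atom at 0 must be excluded. Where V = 0 the variable exp(-n Z) equals 1, so
      q is at most its mean 1 / (1 + n).\<close>
    define q where "q = R.prob {\<omega> \<in> space R. V \<omega> = 0}"
    have "q \<le> inverse (real (Suc n))" for n
    proof -
      have "ennreal q = (\<integral>\<^sup>+u. \<integral>\<^sup>+\<omega>. indicator {\<omega> \<in> space R. V \<omega> = 0} \<omega> \<partial>R \<partial>exp_law 1)"
        using E.emeasure_space_1 by (simp add: q_def R.emeasure_eq_measure)
      also have "\<dots> \<le> (\<integral>\<^sup>+u. \<integral>\<^sup>+\<omega>. ennreal (exp (- real n * Z (u, \<omega>))) \<partial>R \<partial>exp_law 1)"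
        by (intro nn_integral_mono) (auto simp: indicator_def Z_def)
      also have "\<dots> = (\<integral>\<^sup>+x. ennreal (exp (- real n * Z x)) \<partial>(exp_law 1 \<Otimes>\<^sub>M R))"
        by (rule R.nn_integral_fst) measurable
      also have "\<dots> = ennreal (1 / (1 - (- real n)))" by (rule mgfZ) simp
      also have "1 / (1 - (- real n)) = inverse (real (Suc n))" by (simp add: inverse_eq_divide)
      finally show ?thesis by simp
    qed
    then have "q \<le> 0" using LIMSEQ_le_const[OF LIMSEQ_inverse_real_of_nat] by blast
    then have "AE \<omega> in R. V \<omega> \<noteq> 0"
      using AE_iff_measurable[of "{\<omega> \<in> space R. V \<omega> = 0}" R "\<lambda>\<omega>. V \<omega> \<noteq> 0"]
      by (simp add: q_def R.emeasure_eq_measure measure_le_0_iff)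
    then have "(\<integral>\<^sup>+\<omega>. ennreal (W \<omega> powr p) \<partial>R) = (\<integral>\<^sup>+\<omega>. 1 \<partial>R)"
      using VW by (intro nn_integral_cong_AE, eventually_elim) (auto simp: True)
    then show ?thesis using True G_pos by (simp add: R.emeasure_space_1)
  next
    case False
    with p have p: "p > 0" by simp
    have ZE: "(\<integral>\<^sup>+x. ennreal (Z x powr p) \<partial>(exp_law 1 \<Otimes>\<^sub>M R)) = (\<integral>\<^sup>+u. ennreal (u powr p) \<partial>exp_law 1)"
    proof -
      have i: "integrable (exp_law 1 \<Otimes>\<^sub>M R) (\<lambda>x. exp (\<theta> * Z x))" if "\<theta> < 1" for \<theta>
        using mgfZ[OF that] by (intro integrableI_nonneg) auto
      have e: "(\<integral>x. exp (\<theta> * Z x) \<partial>(exp_law 1 \<Otimes>\<^sub>M R)) = (\<integral>u. exp (\<theta> * u) \<partial>exp_law 1)" if "\<theta> < 1" for \<theta>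
        using mgfZ[OF that] exp_law_mgf(2)[OF that] that by (subst integral_eq_nn_integral) auto
      \<comment> \<open>Applied to a constant family: \<open>Z\<close> and a standard exponential
        variable share their exponential moments below 1, and convergence of a constant sequence
        means equality of the power moments.\<close>
      have "((\<lambda>i::nat. \<integral>\<^sup>+x. ennreal (Z x powr p) \<partial>(exp_law 1 \<Otimes>\<^sub>M R)) \<longlongrightarrow> (\<integral>\<^sup>+u. ennreal (u powr p) \<partial>exp_law 1)) sequentially"
        by (rule powr_moments_tendsto[OF p, where Y = "\<lambda>_. Z" and M = "\<lambda>_. exp_law 1 \<Otimes>\<^sub>M R"])
          (use Z0 AE_exp_law_pos[of 1] i e exp_law_mgf(1) in \<open>auto elim!: eventually_mono\<close>)
      then show ?thesis by (simp add: LIMSEQ_const_iff)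
    qed
    have Gp: "Gamma (p * \<alpha> + 1) > 0" using p \<alpha> by (intro Gamma_real_pos) (simp add: add_pos_pos)
    have "(\<integral>\<^sup>+x. ennreal (Z x powr p) \<partial>(exp_law 1 \<Otimes>\<^sub>M R)) = (\<integral>\<^sup>+u. \<integral>\<^sup>+\<omega>. ennreal (Z (u, \<omega>) powr p) \<partial>R \<partial>exp_law 1)"
      by (rule R.nn_integral_fst[symmetric]) measurable
    also have "\<dots> = (\<integral>\<^sup>+u. \<integral>\<^sup>+\<omega>. ennreal (u powr (p * \<alpha>)) * ennreal (V \<omega> powr p) \<partial>R \<partial>exp_law 1)"
      using V0 by (intro nn_integral_cong) (simp add: Z_def powr_mult powr_powr ennreal_mult[symmetric] mult.commute)
    also have "\<dots> = (\<integral>\<^sup>+u. ennreal (u powr (p * \<alpha>)) \<partial>exp_law 1) * (\<integral>\<^sup>+\<omega>. ennreal (V \<omega> powr p) \<partial>R)"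
      by (simp add: nn_integral_cmult nn_integral_multc)
    also have "(\<integral>\<^sup>+u. ennreal (u powr (p * \<alpha>)) \<partial>exp_law 1) = ennreal (Gamma (p * \<alpha> + 1))"
      using nn_integral_exp_law_powr[of 1 "p * \<alpha>"] p \<alpha> by (simp add: less_le_trans[of "-1" 0])
    also have "(\<integral>\<^sup>+\<omega>. ennreal (V \<omega> powr p) \<partial>R) = (\<integral>\<^sup>+\<omega>. ennreal (G powr p) * ennreal (W \<omega> powr p) \<partial>R)"
      using VW Wpos
      by (intro nn_integral_cong_AE, eventually_elim) (use G_pos in \<open>simp add: powr_mult ennreal_mult[symmetric]\<close>)
    also have "\<dots> = ennreal (G powr p) * (\<integral>\<^sup>+\<omega>. ennreal (W \<omega> powr p) \<partial>R)"
      by (simp add: nn_integral_cmult)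
    finally have "ennreal (Gamma (p * \<alpha> + 1)) * (ennreal (G powr p) * (\<integral>\<^sup>+\<omega>. ennreal (W \<omega> powr p) \<partial>R))
        = ennreal (Gamma (p + 1))"
      using ZE nn_integral_exp_law_powr[of 1 p] p by simp
    then have eq: "ennreal (G powr p * Gamma (p * \<alpha> + 1)) * (\<integral>\<^sup>+\<omega>. ennreal (W \<omega> powr p) \<partial>R) = ennreal (Gamma (p + 1))"
      using Gp by (simp add: ennreal_mult mult_ac)
    \<comment> \<open>The moment is isolated by multiplying with 1 / a, the factor a being finite
      and nonzero in \<open>ennreal\<close>.\<close>
    define a where "a = G powr p * Gamma (p * \<alpha> + 1)"
    have a: "a > 0" using Gp G_pos by (simp add: a_def)
    have "(\<integral>\<^sup>+\<omega>. ennreal (W \<omega> powr p) \<partial>R) = ennreal (1 / a * a) * (\<integral>\<^sup>+\<omega>. ennreal (W \<omega> powr p) \<partial>R)"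
      using a by simp
    also have "\<dots> = ennreal (1 / a) * (ennreal a * (\<integral>\<^sup>+\<omega>. ennreal (W \<omega> powr p) \<partial>R))"
      using a by (simp only: ennreal_mult less_imp_le divide_nonneg_pos zero_le_one mult.assoc)
    also have "\<dots> = ennreal (Gamma (p + 1) / a)"
      unfolding eq[folded a_def] using a p by (simp add: ennreal_mult[symmetric] Gamma_real_nonneg)
    finally show ?thesis by (simp add: a_def)
  qed
qed

end

section \<open>Proof of the limit theorem\<close>

theorem theorem1p5:
  fixes P :: "'a measure" and \<xi> :: "'a \<Rightarrow> real"
    and Q :: "'b measure" and X :: "nat \<Rightarrow> 'b \<Rightarrow> real"
    and R :: "'c measure" and W :: "'c \<Rightarrow> real"
    and \<alpha> :: real and L :: "real \<Rightarrow> real"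
  assumes "prob_space P" and "\<xi> \<in> borel_measurable P" and "AE \<omega> in P. \<xi> \<omega> > 0"
    and "0 \<le> \<alpha>" and "\<alpha> < 1"
    and "slowly_varying_at_top L"
    and "\<And>t. t > 0 \<Longrightarrow> \<P>(\<omega> in P. \<xi> \<omega> > t) = t powr (- \<alpha>) * L t"
    and "prob_space Q" and "prob_space.indep_vars Q (\<lambda>_. borel) X {1..}"
    and "\<And>i. i \<ge> 1 \<Longrightarrow> distr Q borel (X i) = distr P borel \<xi>"
    and "prob_space R" and "mittag_leffler_distributed R W \<alpha>"
  shows
    "(\<forall>\<theta>::real.
        ((\<lambda>t. \<integral>\<^sup>+\<omega>. ennreal (exp (\<theta> * (\<P>(\<omega> in P. \<xi> \<omega> > t) * real (first_passage X t \<omega>)))) \<partial>Q)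
          \<longlongrightarrow> (\<integral>\<^sup>+\<omega>. ennreal (exp (\<theta> * W \<omega>)) \<partial>R)) at_top
      \<and> (\<alpha> > 0 \<or> \<bar>\<theta>\<bar> < 1 \<longrightarrow>
          (\<integral>\<^sup>+\<omega>. ennreal (exp (\<theta> * W \<omega>)) \<partial>R)
            = ennreal (mittag_leffler \<alpha> (\<theta> / Gamma (1 - \<alpha>))))
      \<and> (\<alpha> = 0 \<and> \<theta> < 1 \<longrightarrow>
          (\<integral>\<^sup>+\<omega>. ennreal (exp (\<theta> * W \<omega>)) \<partial>R) = ennreal (1 / (1 - \<theta>)))
      \<and> (\<alpha> > 0 \<or> \<theta> < 1 \<longrightarrow> (\<integral>\<^sup>+\<omega>. ennreal (exp (\<theta> * W \<omega>)) \<partial>R) < \<infinity>))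
   \<and> (\<forall>p::real. p \<ge> 0 \<longrightarrow>
        ((\<lambda>t. \<integral>\<^sup>+\<omega>. ennreal ((\<P>(\<omega> in P. \<xi> \<omega> > t) * real (first_passage X t \<omega>)) powr p) \<partial>Q)
          \<longlongrightarrow> (\<integral>\<^sup>+\<omega>. ennreal (W \<omega> powr p) \<partial>R)) at_top
      \<and> (\<integral>\<^sup>+\<omega>. ennreal (W \<omega> powr p) \<partial>R)
            = ennreal (Gamma (p + 1) / (Gamma (1 - \<alpha>) powr p * Gamma (p * \<alpha> + 1)))
      \<and> (\<integral>\<^sup>+\<omega>. ennreal (W \<omega> powr p) \<partial>R) < \<infinity>)"
proof -
  interpret P: prob_space P by fact
  interpret R: prob_space R by fact
  note [measurable] = assms(2)
  have [measurable]: "X (Suc 0) \<in> borel_measurable Q"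
    using assms(9) unfolding prob_space.indep_vars_def[OF assms(8)] by auto
  have distr1: "distr Q borel (X 1) = distr P borel \<xi>" by (rule assms(10)) simp
  have walk: "positive_iid_walk Q X"
  proof (intro positive_iid_walk.intro positive_iid_walk_axioms.intro assms(8,9))
    show "distr Q borel (X i) = distr Q borel (X 1)" if "i \<ge> 1" for i
      unfolding distr1 by (rule assms(10)[OF that])
    have "AE x in distr P borel \<xi>. x > 0" using assms(3) by (subst AE_distr_iff) auto
    then show "AE \<omega> in Q. X 1 \<omega> > 0" unfolding distr1[symmetric] by (subst (asm) AE_distr_iff) auto
  qed
  then interpret Q: positive_iid_walk Q X .
  have tail: "Q.tail t = \<P>(\<omega> in P. \<xi> \<omega> > t)" for t
  proof -
    have "Q.tail t = measure (distr Q borel (X 1)) {t<..}"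
      by (simp add: Q.tail_def measure_distr vimage_def Int_def conj_commute)
    also have "\<dots> = \<P>(\<omega> in P. \<xi> \<omega> > t)"
      unfolding distr1 by (simp add: measure_distr vimage_def Int_def conj_commute)
    finally show ?thesis .
  qed
  have tailL: "Q.tail t = t powr (- \<alpha>) * L t" if "t > 0" for t
    using assms(7)[OF that] by (simp add: tail)
  have Lpos: "\<forall>\<^sub>F t in at_top. L t > 0"
    and Lratio: "\<And>x. x > 0 \<Longrightarrow> ((\<lambda>t. L (x * t) / L t) \<longlongrightarrow> 1) at_top"
    using assms(6) by (auto simp: slowly_varying_at_top_def)
  have "regularly_varying_walk Q X \<alpha>"
  proof (intro regularly_varying_walk.intro regularly_varying_walk_axioms.intro walk assms(4,5))
    \<comment> \<open>The hypothesis on L gives a positive tail at large arguments only;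
      monotonicity carries this back to every t.\<close>
    fix t
    have "\<forall>\<^sub>F u in at_top. L u > 0 \<and> u > 0 \<and> u \<ge> t"
      using Lpos by (intro eventually_conj eventually_gt_at_top eventually_ge_at_top)
    then obtain u where "L u > 0" "u > 0" "u \<ge> t"
      using eventually_happens'[OF trivial_limit_at_top_linorder] by blast
    then have "0 < Q.tail u" by (simp add: tailL)
    also have "\<dots> \<le> Q.tail t" by (rule Q.tail_antimono) fact
    finally show "0 < Q.tail t" .
  next
    fix x :: real assume x: "x > 0"
    have "((\<lambda>t. x powr - \<alpha> * (L (x * t) / L t)) \<longlongrightarrow> x powr - \<alpha> * 1) at_top"
      by (intro tendsto_intros Lratio x)
    moreover have "\<forall>\<^sub>F t in at_top. x powr - \<alpha> * (L (x * t) / L t) = Q.tail (x * t) / Q.tail t"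
      using eventually_gt_at_top[of 0]
      by eventually_elim (use x in \<open>simp add: tailL powr_mult\<close>)
    ultimately show "((\<lambda>t. Q.tail (x * t) / Q.tail t) \<longlongrightarrow> x powr - \<alpha>) at_top"
      by (simp add: Lim_transform_eventually)
  qed
  then interpret Q: regularly_varying_walk Q X \<alpha> .
  have Y: "\<P>(\<omega> in P. \<xi> \<omega> > t) * real (first_passage X t \<omega>) = Q.scaled_passage t \<omega>" for t \<omega>
    by (simp add: Q.scaled_passage_def tail)

  have exponential: "distr R borel W = exp_law 1" if "\<alpha> = 0"
    using assms(12) that distributed_distr_eq_density[of R lborel W]
    by (simp add: mittag_leffler_distributed_def exp_law_def cong: distr_cong)
  have W [measurable]: "W \<in> borel_measurable R"
    using assms(12) distributed_measurable[of R lborel W]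
    by (auto simp: mittag_leffler_distributed_def split: if_splits)
  have mgf: "integrable R (\<lambda>\<omega>. exp (\<theta> * W \<omega>))"
    "(\<integral>\<omega>. exp (\<theta> * W \<omega>) \<partial>R) = (if \<alpha> = 0 then 1 / (1 - \<theta>) else mittag_leffler \<alpha> (\<theta> / Gamma (1 - \<alpha>)))"
    if "\<alpha> > 0 \<or> \<theta> < 1" for \<theta>
  proof -
    have "integrable R (\<lambda>\<omega>. exp (\<theta> * W \<omega>)) \<and> (\<integral>\<omega>. exp (\<theta> * W \<omega>) \<partial>R) =
      (if \<alpha> = 0 then 1 / (1 - \<theta>) else mittag_leffler \<alpha> (\<theta> / Gamma (1 - \<alpha>)))"
    proof (cases "\<alpha> = 0")
      case True
      then have \<theta>: "\<theta> < 1" using that by simp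
      have "integrable (distr R borel W) (\<lambda>u. exp (\<theta> * u))"
        "(\<integral>u. exp (\<theta> * u) \<partial>distr R borel W) = 1 / (1 - \<theta>)"
        unfolding exponential[OF True] by (rule exp_law_mgf[OF \<theta>])+
      then show ?thesis using True by (simp add: integrable_distr_eq integral_distr)
    qed (use assms(12) in \<open>simp add: mittag_leffler_distributed_def\<close>)
    then show "integrable R (\<lambda>\<omega>. exp (\<theta> * W \<omega>))" "(\<integral>\<omega>. exp (\<theta> * W \<omega>) \<partial>R) =
      (if \<alpha> = 0 then 1 / (1 - \<theta>) else mittag_leffler \<alpha> (\<theta> / Gamma (1 - \<alpha>)))" by auto
  qed
  \<comment> \<open>The pointwise limits of the generating functions are used at u = 1.\<close>
  have lim: "((\<lambda>t. Q.real_pgf (exp (\<theta> * Q.tail t)) t) \<longlongrightarrow> (\<integral>\<omega>. exp (\<theta> * W \<omega>) \<partial>R)) at_top"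
    if "\<alpha> > 0 \<or> \<theta> < 1" for \<theta>
    using Q.real_pgf_tendsto_exponential[of \<theta> 1] Q.real_pgf_tendsto_mittag_leffler[of 1 \<theta>] that assms(4)
    by (auto simp: mgf[OF that])
  have nnW: "(\<integral>\<^sup>+\<omega>. ennreal (exp (\<theta> * W \<omega>)) \<partial>R) = ennreal (\<integral>\<omega>. exp (\<theta> * W \<omega>) \<partial>R)"
    if "\<alpha> > 0 \<or> \<theta> < 1" for \<theta>
    by (intro nn_integral_eq_integral mgf that) simp
  have limY: "((\<lambda>t. \<integral>\<^sup>+\<omega>. ennreal (exp (\<theta> * Q.scaled_passage t \<omega>)) \<partial>Q) \<longlongrightarrow> (\<integral>\<^sup>+\<omega>. ennreal (exp (\<theta> * W \<omega>)) \<partial>R)) at_top"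
    if "\<alpha> > 0 \<or> \<theta> < 1" for \<theta>
    unfolding nnW[OF that] Q.nn_integral_exp_scaled_passage
    by (rule Lim_transform_eventually[OF tendsto_ennrealI[OF lim[OF that]]])
      (use Q.eventually_exp_scaled_passage[OF that] in \<open>auto elim!: eventually_mono\<close>)
  have Wnonneg: "AE \<omega> in R. 0 \<le> W \<omega>"
    by (rule Q.limit_nonneg) (use mgf lim in \<open>auto intro: assms(11)\<close>)

  \<comment> \<open>What remains is \<alpha> = 0 and \<theta> \<ge> 1, where both sides are
    infinite. The moment of W dominates those at \<eta> < 1, which are unbounded. The moments of the
    scaled passage time dominate their own values at \<eta>, and these converge to the same
    unbounded quantities.\<close>
  have exp_moments: "((\<lambda>t. \<integral>\<^sup>+\<omega>. ennreal (exp (\<theta> * Q.scaled_passage t \<omega>)) \<partial>Q) \<longlongrightarrow> (\<integral>\<^sup>+\<omega>. ennreal (exp (\<theta> * W \<omega>)) \<partial>R)) at_top" for \<theta>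
  proof (cases "\<alpha> > 0 \<or> \<theta> < 1")
    case False
    then have \<alpha>: "\<alpha> = 0" and \<theta>: "\<theta> \<ge> 1" using assms(4) by auto
    \<comment> \<open>With \<eta> = 1 - 1 / B the exponential moment 1 / (1 - \<eta>) is exactly
      B.\<close>
    have big: "\<exists>\<eta><1. (\<integral>\<^sup>+\<omega>. ennreal (exp (\<eta> * W \<omega>)) \<partial>R) = ennreal B" if "B \<ge> 1" for B
      using nnW[of "1 - 1 / B"] mgf(2)[of "1 - 1 / B"] \<alpha> that by (intro exI[of _ "1 - 1 / B"]) auto
    have ge: "ennreal B \<le> (\<integral>\<^sup>+\<omega>. ennreal (exp (\<theta> * W \<omega>)) \<partial>R)" if B: "B \<ge> 1" for B
    proof -
      obtain \<eta> where \<eta>: "\<eta> < 1" "(\<integral>\<^sup>+\<omega>. ennreal (exp (\<eta> * W \<omega>)) \<partial>R) = ennreal B" using big[OF B] by blast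
      have "(\<integral>\<^sup>+\<omega>. ennreal (exp (\<eta> * W \<omega>)) \<partial>R) \<le> (\<integral>\<^sup>+\<omega>. ennreal (exp (\<theta> * W \<omega>)) \<partial>R)"
        using Wnonneg \<eta>(1) \<theta>
        by (intro nn_integral_mono_AE) (auto elim!: eventually_mono intro!: ennreal_leI mult_right_mono)
      then show ?thesis unfolding \<eta>(2) .
    qed
    have top: "(\<integral>\<^sup>+\<omega>. ennreal (exp (\<theta> * W \<omega>)) \<partial>R) = \<top>"
    proof (cases "\<integral>\<^sup>+\<omega>. ennreal (exp (\<theta> * W \<omega>)) \<partial>R")
      case (real c)
      then show ?thesis using ge[of "c + 1"] by simp
    qed
    show ?thesis unfolding top
    proof (rule order_tendstoI)
      fix b :: ennreal assume "b < \<top>"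
      then obtain B where B: "B \<ge> 0" "b = ennreal B" by (cases b) auto
      obtain \<eta> where \<eta>: "\<eta> < 1" "(\<integral>\<^sup>+\<omega>. ennreal (exp (\<eta> * W \<omega>)) \<partial>R) = ennreal (B + 1)" using big[of "B + 1"] B by auto
      have "\<forall>\<^sub>F t in at_top. b < (\<integral>\<^sup>+\<omega>. ennreal (exp (\<eta> * Q.scaled_passage t \<omega>)) \<partial>Q)"
        using B \<eta> by (intro order_tendstoD(1)[OF limY]) (auto simp: ennreal_less_iff)
      then show "\<forall>\<^sub>F t in at_top. b < (\<integral>\<^sup>+\<omega>. ennreal (exp (\<theta> * Q.scaled_passage t \<omega>)) \<partial>Q)"
      proof eventually_elim
        case (elim t)
        also have "(\<integral>\<^sup>+\<omega>. ennreal (exp (\<eta> * Q.scaled_passage t \<omega>)) \<partial>Q) \<le> (\<integral>\<^sup>+\<omega>. ennreal (exp (\<theta> * Q.scaled_passage t \<omega>)) \<partial>Q)"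
          using \<eta>(1) \<theta> by (intro nn_integral_mono) (auto intro!: ennreal_leI mult_right_mono)
        finally show ?case .
      qed
    qed simp
  qed (rule limY)

  have W_moments: "(\<integral>\<^sup>+\<omega>. ennreal (W \<omega> powr p) \<partial>R) =
      ennreal (Gamma (p + 1) / (Gamma (1 - \<alpha>) powr p * Gamma (p * \<alpha> + 1)))" if p: "p \<ge> 0" for p
  proof (cases "\<alpha> = 0")
    case True
    have "(\<integral>\<^sup>+\<omega>. ennreal (W \<omega> powr p) \<partial>R) = (\<integral>\<^sup>+u. ennreal (u powr p) \<partial>distr R borel W)"
      by (simp add: nn_integral_distr)
    also have "\<dots> = ennreal (Gamma (p + 1))"
      unfolding exponential[OF True] using nn_integral_exp_law_powr[of 1 p] p by simp
    finally show ?thesis using True by simp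
  next
    case False
    then have "\<alpha> > 0" using assms(4) by simp
    then show ?thesis using mgf False
      by (intro Q.mittag_leffler_moments assms(11) W Wnonneg p) auto
  qed
  have Y_moments: "((\<lambda>t. \<integral>\<^sup>+\<omega>. ennreal (Q.scaled_passage t \<omega> powr p) \<partial>Q) \<longlongrightarrow> (\<integral>\<^sup>+\<omega>. ennreal (W \<omega> powr p) \<partial>R)) at_top"
    if p: "p \<ge> 0" for p
  proof (cases "p = 0")
    case True
    have "(\<integral>\<^sup>+\<omega>. ennreal (Q.scaled_passage t \<omega> powr p) \<partial>Q) = (\<integral>\<^sup>+\<omega>. 1 \<partial>Q)" for t
      using Q.AE_scaled_passage_pos[OF Q.tail_pos[of t]] True by (intro nn_integral_cong_AE) (auto elim!: eventually_mono)
    then have "(\<integral>\<^sup>+\<omega>. ennreal (Q.scaled_passage t \<omega> powr p) \<partial>Q) = 1" for t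
      by (simp add: Q.emeasure_space_1)
    moreover have "(\<integral>\<^sup>+\<omega>. ennreal (W \<omega> powr p) \<partial>R) = 1"
      unfolding W_moments[OF p] using True Q.G_pos by simp
    ultimately show ?thesis by simp
  next
    case False
    then show ?thesis using p by (intro Q.moments_tendsto assms(11) W mgf lim) auto
  qed
  have ml: "(\<integral>\<^sup>+\<omega>. ennreal (exp (\<theta> * W \<omega>)) \<partial>R) = ennreal (mittag_leffler \<alpha> (\<theta> / Gamma (1 - \<alpha>)))"
    if "\<alpha> > 0 \<or> \<bar>\<theta>\<bar> < 1" for \<theta>
  proof -
    have adm: "\<alpha> > 0 \<or> \<theta> < 1" using that by auto
    have "mittag_leffler 0 \<theta> = 1 / (1 - \<theta>)" if "\<bar>\<theta>\<bar> < 1"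
      using that by (simp add: mittag_leffler_def suminf_geometric)
    then show ?thesis using that unfolding nnW[OF adm] mgf(2)[OF adm] by (cases "\<alpha> = 0") simp_all
  qed
  show ?thesis
    unfolding Y using exp_moments W_moments Y_moments ml nnW mgf(2)
    by auto
qed

end
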